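(* Let $\overline Z$ and $\underline Z$ be respectively the optimal values of the optimization programs $$\max\ \psi(P_X)\quad\text{and}\quad \min\ \psi(P_X)\qquad\text{subject to}\quad \|F_Y-\hat F_Y\|_\infty\le\frac{q_{1-\alpha}}{\sqrt n},\quad P_X\in\mathcal P_X, \tag{A}$$ where $F_Y(y)=E_{P_X}[I(h(\mathbf X)\le y)]$ is the distribution function of the output under $P_X$, $q_{1-\alpha}$ is the $(1-\alpha)$-quantile of $\sup_{u\in[0,1]}|BB(u)|$ with $BB$ a standard Brownian bridge on $[0,1]$, and $\hat F_Y$ is the empirical distribution function of the i.i.d. output data $y_1,\dots,y_n$. Supposing the true output distribution is continuous, we have $$\liminf_{n\to\infty}\mathbb P_D(\underline Z\le\psi(P_X^0)\le\overline Z)\ge 1-\alpha,$$ where $P_X^0$ is the true distribution of the input variate $X$. Moreover, the two programs in (A) are equivalent to, respectively, the maximization and the minimization of $\psi(P_X)$ subject to $$\hat F_Y(y_j+)-\frac{q_{1-\alpha}}{\sqrt n}\le E_{P_X}[I(h(\mathbf X)\le y_j)]\le\hat F_Y(y_j-)+\frac{q_{1-\alpha}}{\sqrt n},\quad j=1,\dots,n,\qquad P_X\in\mathcal P_X,$$ where $\hat F_Y(y_j+)$ and $\hat F_Y(y_j-)$ are the right and left limits of $\hat F_Y$ at $y_j$, and $E_{P_X}[\cdot]$ denotes the expectation taken with respect to the $T$-fold product measure of $P_X$.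
   Context: An input variate $X$ takes values in a space $\mathcal X$ and has distribution $P_X$; $\mathcal P_X$ is the space of all possible input distributions, and it contains the true input distribution $P_X^0$. For a fixed time horizon $T$, $\mathbf X=(X_1,\dots,X_T)$ is an i.i.d. sequence with marginal distribution $P_X$. The function $h$ maps the input sequence $\mathbf X$ to a real-valued output $Y=h(\mathbf X)$; it is completely specified and computable. The data $D=\{y_1,\dots,y_n\}$ are i.i.d. observations of $h(\mathbf X)$ under $P_X^0$, and the true output distribution is the distribution of $h(\mathbf X)$ under $P_X^0$; $\mathbb P_D$ is probability with respect to $D$. $\psi$ is a real-valued target quantity depending on $P_X$ (for instance the distribution function of $P_X$ at a point, or an expectation $E_{P_X}[g(\mathbf X)]$ for a function $g$ of an i.i.d. input sequence). $\|\cdot\|_\infty$ is the sup norm over $\mathbb R$, $I(\cdot)$ is the indicator function, and $1-\alpha$ is the confidence level, with $\alpha\in(0,1)$.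
   Formalization: The "Moreover" equivalence is stated when every P_X feasible for (A) has F_Y continuous at y_1,…,y_n; it fails in general, since F_Y may jump at a data point. Without this, only the implication from the second constraint to the first is claimed. *)

theory Defs
  imports "HOL-Probability.Probability"
begin

definition input_seq :: "nat \<Rightarrow> 'x measure \<Rightarrow> (nat \<Rightarrow> 'x) measure" where
  "input_seq T P = Pi\<^sub>M {1..T} (\<lambda>_. P)"

definition output_cdf :: "nat \<Rightarrow> ((nat \<Rightarrow> 'x) \<Rightarrow> real) \<Rightarrow> 'x measure \<Rightarrow> real \<Rightarrow> real" where
  "output_cdf T h P t = (\<integral>x. indicator {x. h x \<le> t} x \<partial>input_seq T P)"

definition empirical_cdf :: "nat \<Rightarrow> (nat \<Rightarrow> real) \<Rightarrow> real \<Rightarrow> real" where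
  "empirical_cdf n y t = (\<Sum>j=1..n. indicator {..t} (y j)) / real n"

(* Only meaningful for bounded f; it is applied to differences of distribution functions. *)
definition sup_norm :: "(real \<Rightarrow> real) \<Rightarrow> real" where
  "sup_norm f = (SUP t. \<bar>f t\<bar>)"

definition left_lim :: "(real \<Rightarrow> real) \<Rightarrow> real \<Rightarrow> real" where
  "left_lim f t = Lim (at_left t) f"

definition right_lim :: "(real \<Rightarrow> real) \<Rightarrow> real \<Rightarrow> real" where
  "right_lim f t = Lim (at_right t) f"

(* Point masses count as (degenerate) Gaussian laws. *)
definition gaussian_law :: "real measure \<Rightarrow> bool" where
  "gaussian_law M \<longleftrightarrow>
     (\<exists>\<mu> \<sigma>. 0 < \<sigma> \<and> M = density lborel (\<lambda>x. ennreal (normal_density \<mu> \<sigma> x))) \<or>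
     (\<exists>\<mu>. M = return borel \<mu>)"

definition gaussian_process :: "'w measure \<Rightarrow> real set \<Rightarrow> (real \<Rightarrow> 'w \<Rightarrow> real) \<Rightarrow> bool" where
  "gaussian_process W I X \<longleftrightarrow>
     (\<forall>t\<in>I. X t \<in> borel_measurable W) \<and>
     (\<forall>S c. finite S \<and> S \<subseteq> I \<longrightarrow>
        gaussian_law (distr W borel (\<lambda>\<omega>. \<Sum>t\<in>S. c t * X t \<omega>)))"

(* All paths, not just almost all, are continuous: this makes the supremum of the absolute
   value a random variable without completing W. *)
definition brownian_bridge :: "'w measure \<Rightarrow> (real \<Rightarrow> 'w \<Rightarrow> real) \<Rightarrow> bool" where
  "brownian_bridge W BB \<longleftrightarrow>
     prob_space W \<and>
     gaussian_process W {0..1} BB \<and>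
     (\<forall>t\<in>{0..1}. (\<integral>\<omega>. BB t \<omega> \<partial>W) = 0) \<and>
     (\<forall>s\<in>{0..1}. \<forall>t\<in>{0..1}. (\<integral>\<omega>. BB s \<omega> * BB t \<omega> \<partial>W) = min s t - s * t) \<and>
     (\<forall>\<omega>\<in>space W. continuous_on {0..1} (\<lambda>t. BB t \<omega>))"

definition quantile :: "real measure \<Rightarrow> real \<Rightarrow> real" where
  "quantile M p = Inf {x. p \<le> cdf M x}"

definition sup_bridge_quantile :: "'w measure \<Rightarrow> (real \<Rightarrow> 'w \<Rightarrow> real) \<Rightarrow> real \<Rightarrow> real" where
  "sup_bridge_quantile W BB p =
     quantile (distr W borel (\<lambda>\<omega>. SUP u\<in>{0..1}. \<bar>BB u \<omega>\<bar>)) p"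

definition ks_feasible ::
  "nat \<Rightarrow> ((nat \<Rightarrow> 'x) \<Rightarrow> real) \<Rightarrow> 'x measure set \<Rightarrow> real \<Rightarrow> nat \<Rightarrow> (nat \<Rightarrow> real) \<Rightarrow> 'x measure set" where
  "ks_feasible T h PX q n y =
     {P \<in> PX. sup_norm (\<lambda>t. output_cdf T h P t - empirical_cdf n y t) \<le> q / sqrt (real n)}"

definition pointwise_feasible ::
  "nat \<Rightarrow> ((nat \<Rightarrow> 'x) \<Rightarrow> real) \<Rightarrow> 'x measure set \<Rightarrow> real \<Rightarrow> nat \<Rightarrow> (nat \<Rightarrow> real) \<Rightarrow> 'x measure set" where
  "pointwise_feasible T h PX q n y =
     {P \<in> PX. \<forall>j\<in>{1..n}.
        right_lim (empirical_cdf n y) (y j) - q / sqrt (real n)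
          \<le> (\<integral>x. indicator {x. h x \<le> y j} x \<partial>input_seq T P) \<and>
        (\<integral>x. indicator {x. h x \<le> y j} x \<partial>input_seq T P)
          \<le> left_lim (empirical_cdf n y) (y j) + q / sqrt (real n)}"

(* Optimal values are extended reals: the program may be unbounded, unattained or infeasible
   (an infeasible maximization has value -infinity, an infeasible minimization +infinity). *)
definition max_value :: "('x measure \<Rightarrow> real) \<Rightarrow> 'x measure set \<Rightarrow> ereal" where
  "max_value \<psi> S = (SUP P\<in>S. ereal (\<psi> P))"

definition min_value :: "('x measure \<Rightarrow> real) \<Rightarrow> 'x measure set \<Rightarrow> ereal" where
  "min_value \<psi> S = (INF P\<in>S. ereal (\<psi> P))"

(* For arbitrary target and input family, the coverage event need not be measurable.
   The inner probability is defined for every set and is the probability of every event. *)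
definition inner_prob :: "'d measure \<Rightarrow> 'd set \<Rightarrow> real" where
  "inner_prob M A = (SUP B\<in>{B \<in> sets M. B \<subseteq> A}. measure M B)"

lemma (in prob_space) inner_prob_event:
  assumes "A \<in> events"
  shows "inner_prob M A = prob A"
  unfolding inner_prob_def
  by (rule cSup_eq_maximum) (use assms in \<open>auto intro: finite_measure_mono\<close>)

end

theory Submission
  imports Defs
begin

text \<open>
  For the coverage statement it suffices that the true input law satisfies the
  Kolmogorov-Smirnov constraint with the stated asymptotic probability. Transforming the data by
  their continuous distribution function reduces this to the uniform empirical process
  \<open>\<surd>n (G\<^sub>n(u) - u)\<close>. Its finite-dimensional characteristic functions converge by
  the one-dimensional central limit theorem, and the event that finitely many coordinates lie in
  a symmetric interval is controlled by products of polynomials in cosines, whose expectations are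
  finite combinations of characteristic functions. A fourth-moment bound and dyadic chaining pass
  from a finite grid to the supremum.

  Passing to the limit needs that the supremum of the bridge has no atom at the quantile \<open>q\<close>. For
  this the bridge is replaced by one with the same characteristic functions whose component
  along the value at \<open>1/2\<close> is an independent Gaussian coordinate \<open>z\<close>: with everything else fixed,
  the supremum is a convex function of \<open>z\<close> that is not constantly \<open>q > 0\<close> on any interval, so it
  takes the value \<open>q\<close> at most twice.
\<close>

section \<open>Comparison of finite-dimensional distributions\<close>

text \<open>Only a lower bound on the coverage is claimed, so all comparisons of probabilities run
  in one direction: a closed band of half-width \<open>c\<close> below \<open>q\<close> for the
  bridge is compared with an open, slightly wider band for the empirical process. This is what makes
  an atom at \<open>q\<close> harmful. The quantile only gives P(sup \<le> q) \<ge> 1 - \<alpha>,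
  while the comparison and the chaining both spend room below \<open>q\<close>, so the bound is
  needed for P(sup < q).

  Cosines are periodic, so a product of polynomials in cosines resembles the indicator of a box only
  within one period; tightness confines the variables to it.

  Fourth moments are forced by the chaining: dyadic level r has 2^r increments, each of variance
  about 2^(-r), and Chebyshev bounds for them do not sum. The fourth-moment bound is quadratic in
  the length only down to length 1/n; below that, the monotonicity of the empirical distribution
  function takes over.\<close>

inductive trig_sum :: "'i set \<Rightarrow> (('i \<Rightarrow> real) \<Rightarrow> complex) \<Rightarrow> bool" for J where
  iexp: "trig_sum J (\<lambda>x. iexp (\<Sum>j\<in>J. c j * x j))"
| scale: "trig_sum J f \<Longrightarrow> trig_sum J (\<lambda>x. a * f x)"
| add: "trig_sum J f \<Longrightarrow> trig_sum J g \<Longrightarrow> trig_sum J (\<lambda>x. f x + g x)"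

text \<open>Products add frequencies, so these sums form an algebra; polynomials in the cosine of
  one coordinate, and products of them over coordinates, thus stay within reach of characteristic
  functions.\<close>

lemma trig_sum_mult:
  assumes "trig_sum J f" "trig_sum J g"
  shows "trig_sum J (\<lambda>x. f x * g x)"
  using assms(1)
proof induction
  case (iexp c)
  show ?case
    using assms(2)
  proof induction
    case (iexp d)
    have "trig_sum J (\<lambda>x. iexp (\<Sum>j\<in>J. (c j + d j) * x j))"
      by (rule trig_sum.iexp)
    then show ?case
      by (simp add: algebra_simps sum.distrib flip: exp_add)
  next
    case (scale f a)
    from trig_sum.scale[OF scale.IH, of a] show ?case
      by (simp add: ac_simps)
  next
    case (add f g)
    from trig_sum.add[OF add.IH] show ?case
      by (simp add: distrib_left)
  qed
next
  case (scale f a)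
  from trig_sum.scale[OF scale.IH, of a] show ?case
    by (simp add: ac_simps)
next
  case (add f g)
  from trig_sum.add[OF add.IH] show ?case
    by (simp add: distrib_right)
qed

lemma trig_sum_const: "trig_sum J (\<lambda>x. a)"
  using trig_sum.scale[OF trig_sum.iexp[of J "\<lambda>_. 0"], of a] by simp

lemma trig_sum_prod:
  assumes "finite K" "\<And>k. k \<in> K \<Longrightarrow> trig_sum J (f k)"
  shows "trig_sum J (\<lambda>x. \<Prod>k\<in>K. f k x)"
  using assms by (induction K) (auto intro: trig_sum_mult trig_sum_const)

lemma trig_sum_cos:
  assumes "finite J" "j \<in> J"
  shows "trig_sum J (\<lambda>x. complex_of_real (cos (\<theta> * x j)))"
proof -
  have *: "(\<Sum>i\<in>J. (if i = j then s else 0) * x i) = s * x j" for s and x :: "_ \<Rightarrow> real"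
    using assms by (simp add: if_distrib[of "\<lambda>r. r * _"] sum.delta cong: if_cong)
  have "trig_sum J (\<lambda>x. (1/2) * (iexp (\<Sum>i\<in>J. (if i = j then \<theta> else 0) * x i) +
          iexp (\<Sum>i\<in>J. (if i = j then - \<theta> else 0) * x i)))"
    by (intro trig_sum.scale trig_sum.add trig_sum.iexp)
  also have "(\<lambda>x. (1/2) * (iexp (\<Sum>i\<in>J. (if i = j then \<theta> else 0) * x i) +
          iexp (\<Sum>i\<in>J. (if i = j then - \<theta> else 0) * x i))) =
     (\<lambda>x. complex_of_real (cos (\<theta> * x j)))"
    unfolding * by (rule ext) (simp flip: cos_of_real add: cos_exp_eq)
  finally show ?thesis .
qed

lemma trig_sum_real_polynomial:
  assumes "real_polynomial_function p" "trig_sum J (\<lambda>x. complex_of_real (f x))"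
  shows "trig_sum J (\<lambda>x. complex_of_real (p (f x)))"
  using assms(1)
proof induction
  case (linear g)
  then obtain c where "g = (\<lambda>x. x * c)"
    using real_bounded_linear by blast
  with trig_sum.scale[OF assms(2), of "of_real c"] show ?case
    by (simp add: ac_simps)
next
  case (const c)
  show ?case by (rule trig_sum_const)
next
  case (add f g)
  from trig_sum.add[OF add.IH] show ?case by simp
next
  case (mult f g)
  from trig_sum_mult[OF mult.IH] show ?case by simp
qed

lemma trig_sum_integral_tendsto:
  fixes V :: "nat \<Rightarrow> 'i \<Rightarrow> 'a \<Rightarrow> real" and X :: "'i \<Rightarrow> 'b \<Rightarrow> real"
  assumes "prob_space M" "prob_space N"
    and V [measurable]: "\<And>n j. j \<in> J \<Longrightarrow> V n j \<in> borel_measurable M"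
    and X [measurable]: "\<And>j. j \<in> J \<Longrightarrow> X j \<in> borel_measurable N"
    and lim: "\<And>c. (\<lambda>n. \<integral>\<omega>. iexp (\<Sum>j\<in>J. c j * V n j \<omega>) \<partial>M)
                \<longlonglongrightarrow> (\<integral>\<omega>. iexp (\<Sum>j\<in>J. c j * X j \<omega>) \<partial>N)"
    and "trig_sum J f"
  shows "(\<lambda>n. \<integral>\<omega>. f (\<lambda>j. V n j \<omega>) \<partial>M) \<longlonglongrightarrow> (\<integral>\<omega>. f (\<lambda>j. X j \<omega>) \<partial>N)"
proof -
  interpret M: prob_space M by fact
  interpret N: prob_space N by fact
  \<comment> \<open>Integrability is carried along because the integral of a sum splits only for
    integrable summands.\<close>
  have "(\<forall>n. integrable M (\<lambda>\<omega>. f (\<lambda>j. V n j \<omega>))) \<and> integrable N (\<lambda>\<omega>. f (\<lambda>j. X j \<omega>)) \<and>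
    (\<lambda>n. \<integral>\<omega>. f (\<lambda>j. V n j \<omega>) \<partial>M) \<longlonglongrightarrow> (\<integral>\<omega>. f (\<lambda>j. X j \<omega>) \<partial>N)"
    using \<open>trig_sum J f\<close>
  proof induction
    case (iexp c)
    show ?case
      by (intro conjI allI lim M.integrable_iexp N.integrable_iexp) auto
  next
    case (scale f a)
    then show ?case by (auto intro!: tendsto_intros)
  next
    case (add f g)
    then show ?case by (auto intro!: tendsto_intros)
  qed
  then show ?thesis by blast
qed

text \<open>The ramp is squeezed into [\<epsilon>/2, 1 - \<epsilon>/2] before Weierstrass
  approximation with error below \<epsilon>/2: the polynomial then stays in [0,1] on all of [-1,1],
  the range of the cosine, and can be multiplied over coordinates.\<close>

lemma real_polynomial_step:
  fixes a b \<epsilon> :: real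
  assumes "a < b" "0 < \<epsilon>" "\<epsilon> < 1"
  obtains p where "real_polynomial_function p"
    "\<And>y. y \<in> {-1..1} \<Longrightarrow> 0 \<le> p y \<and> p y \<le> 1"
    "\<And>y. y \<in> {-1..1} \<Longrightarrow> b \<le> y \<Longrightarrow> 1 - \<epsilon> \<le> p y"
    "\<And>y. y \<in> {-1..1} \<Longrightarrow> y \<le> a \<Longrightarrow> p y \<le> \<epsilon>"
proof -
  define \<phi> where "\<phi> y = \<epsilon> / 2 + (1 - \<epsilon>) * max 0 (min 1 ((y - a) / (b - a)))" for y
  have "continuous_on {-1..1} \<phi>"
    unfolding \<phi>_def using assms by (auto intro!: continuous_intros)
  then obtain p where p: "real_polynomial_function p" "\<And>y. y \<in> {-1..1} \<Longrightarrow> \<bar>\<phi> y - p y\<bar> < \<epsilon> / 2"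
    using Stone_Weierstrass_real_polynomial_function[of "{-1..1}" \<phi> "\<epsilon>/2"] assms
    by auto
  have *: "\<epsilon> / 2 \<le> \<phi> y" "\<phi> y \<le> 1 - \<epsilon> / 2" for y
  proof -
    show "\<epsilon> / 2 \<le> \<phi> y" unfolding \<phi>_def using assms by auto
    have "(1 - \<epsilon>) * max 0 (min 1 ((y - a) / (b - a))) \<le> (1 - \<epsilon>) * 1"
      using assms by (intro mult_left_mono) auto
    then show "\<phi> y \<le> 1 - \<epsilon> / 2" unfolding \<phi>_def by simp
  qed
  show ?thesis
  proof
    show "real_polynomial_function p" by fact
    fix y :: real assume y: "y \<in> {-1..1}"
    show "0 \<le> p y \<and> p y \<le> 1"
      using p(2)[OF y] *[of y] unfolding abs_less_iff by linarith
    show "1 - \<epsilon> \<le> p y" if "b \<le> y"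
    proof -
      have "\<phi> y = 1 - \<epsilon> / 2"
        using that assms by (simp add: \<phi>_def max_def min_def)
      then show ?thesis using p(2)[OF y] unfolding abs_less_iff by linarith
    qed
    show "p y \<le> \<epsilon>" if "y \<le> a"
    proof -
      have "(y - a) / (b - a) \<le> 0"
        using that assms by (simp add: divide_nonpos_pos)
      then have "\<phi> y = \<epsilon> / 2"
        by (simp add: \<phi>_def max_def min_def)
      then show ?thesis using p(2)[OF y] unfolding abs_less_iff by linarith
    qed
  qed
qed

lemma prod_le_factor:
  assumes "finite J" "\<And>j. j \<in> J \<Longrightarrow> 0 \<le> z j \<and> z j \<le> (1::real)" "i \<in> J"
  shows "(\<Prod>j\<in>J. z j) \<le> z i"
proof -
  have "(\<Prod>j\<in>J. z j) = z i * (\<Prod>j\<in>J - {i}. z j)"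
    using assms by (simp add: prod.remove)
  also have "\<dots> \<le> z i * 1"
    using assms by (intro mult_left_mono prod_le_1) auto
  finally show ?thesis by simp
qed

text \<open>One half of the portmanteau theorem, for boxes. The product of the factors
  \<open>z (x j)\<close> is nearly 1 on the inner box and, while all coordinates stay within
  \<open>L\<close>, nearly 0 off the outer one. Periodicity spoils the second property beyond
  \<open>L\<close>, where the tightness hypothesis steps in.\<close>

lemma eventually_prob_all_abs_less:
  fixes V :: "nat \<Rightarrow> 'i \<Rightarrow> 'a \<Rightarrow> real" and X :: "'i \<Rightarrow> 'b \<Rightarrow> real"
  assumes M: "prob_space M" and N: "prob_space N" and J: "finite J"
    and V [measurable]: "\<And>n j. j \<in> J \<Longrightarrow> V n j \<in> borel_measurable M"
    and X [measurable]: "\<And>j. j \<in> J \<Longrightarrow> X j \<in> borel_measurable N"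
    and lim: "\<And>c. (\<lambda>n. \<integral>\<omega>. iexp (\<Sum>j\<in>J. c j * V n j \<omega>) \<partial>M)
                \<longlonglongrightarrow> (\<integral>\<omega>. iexp (\<Sum>j\<in>J. c j * X j \<omega>) \<partial>N)"
    and tight: "\<And>e. 0 < e \<Longrightarrow> \<exists>L. \<forall>n. \<forall>j\<in>J. measure M {\<omega> \<in> space M. L < \<bar>V n j \<omega>\<bar>} \<le> e"
    and "0 \<le> c'" "c' < c" "0 < \<delta>"
  shows "\<forall>\<^sub>F n in sequentially. measure N {\<omega> \<in> space N. \<forall>j\<in>J. \<bar>X j \<omega>\<bar> \<le> c'} - \<delta>
           \<le> measure M {\<omega> \<in> space M. \<forall>j\<in>J. \<bar>V n j \<omega>\<bar> < c}"
proof -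
  interpret M: prob_space M by fact
  interpret N: prob_space N by fact
  \<comment> \<open>In the lower estimate each of the \<open>card J\<close> factors costs one
    \<epsilon>, by Bernoulli's inequality; the upper one pays \<epsilon> for each tail event and
    once more for a small factor. Either way the loss is at most \<delta>/4.\<close>
  define \<epsilon> where "\<epsilon> = min (1/2) (\<delta> / (4 * (real (card J) + 1)))"
  have \<epsilon>: "0 < \<epsilon>" "\<epsilon> < 1" "(real (card J) + 1) * \<epsilon> \<le> \<delta> / 4"
  proof -
    show "0 < \<epsilon>" "\<epsilon> < 1" unfolding \<epsilon>_def using \<open>0 < \<delta>\<close> by auto
    have "(real (card J) + 1) * \<epsilon> \<le> (real (card J) + 1) * (\<delta> / (4 * (real (card J) + 1)))"
      unfolding \<epsilon>_def by (intro mult_left_mono) auto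
    also have "\<dots> = \<delta> / 4" by (simp add: field_simps)
    finally show "(real (card J) + 1) * \<epsilon> \<le> \<delta> / 4" .
  qed
  obtain L0 where L0: "\<And>n j. j \<in> J \<Longrightarrow> measure M {\<omega> \<in> space M. L0 < \<bar>V n j \<omega>\<bar>} \<le> \<epsilon>"
    using tight[OF \<epsilon>(1)] by blast
  define L where "L = max L0 c"
  have L: "0 < L" "c \<le> L" using assms by (auto simp: L_def)
  have tightL: "measure M {\<omega> \<in> space M. L < \<bar>V n j \<omega>\<bar>} \<le> \<epsilon>" if "j \<in> J" for n j
  proof -
    have "measure M {\<omega> \<in> space M. L < \<bar>V n j \<omega>\<bar>} \<le> measure M {\<omega> \<in> space M. L0 < \<bar>V n j \<omega>\<bar>}"
      using that by (intro M.finite_measure_mono) (auto simp: L_def)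
    with L0[OF that, of n] show ?thesis by simp
  qed
  \<comment> \<open>With half-period \<open>L\<close> the cosine decreases in the absolute value of
    its argument up to \<open>L\<close>, so bounds on absolute values become bounds on
    cosines.\<close>
  define \<theta> where "\<theta> = pi / L"
  have \<theta>: "0 < \<theta>" "\<theta> * L = pi" using L by (auto simp: \<theta>_def)
  have \<theta>_le: "\<theta> * x \<le> pi \<longleftrightarrow> x \<le> L" for x
    using \<theta> by (metis mult_le_cancel_left_pos)
  have "cos (\<theta> * c) < cos (\<theta> * c')"
    using assms L \<theta> \<theta>_le[of c] by (intro cos_monotone_0_pi) auto
  from real_polynomial_step[OF this \<epsilon>(1,2)] obtain p where
    p: "real_polynomial_function p"
    "\<And>y. y \<in> {-1..1} \<Longrightarrow> 0 \<le> p y \<and> p y \<le> 1"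
    "\<And>y. y \<in> {-1..1} \<Longrightarrow> cos (\<theta> * c') \<le> y \<Longrightarrow> 1 - \<epsilon> \<le> p y"
    "\<And>y. y \<in> {-1..1} \<Longrightarrow> y \<le> cos (\<theta> * c) \<Longrightarrow> p y \<le> \<epsilon>"
    by metis
  have cos_abs: "cos (\<theta> * \<bar>x\<bar>) = cos (\<theta> * x)" for x
    by (cases "0 \<le> x") auto
  define z where "z x = p (cos (\<theta> * x))" for x
  have z01: "0 \<le> z x" "z x \<le> 1" for x
    using p(2)[of "cos (\<theta> * x)"] by (auto simp: z_def)
  have z_in: "1 - \<epsilon> \<le> z x" if "\<bar>x\<bar> \<le> c'" for x
  proof -
    have "cos (\<theta> * c') \<le> cos (\<theta> * \<bar>x\<bar>)"
      using that assms L \<theta> \<theta>_le[of c'] by (intro cos_monotone_0_pi_le) auto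
    then show ?thesis unfolding z_def cos_abs by (intro p(3)) auto
  qed
  have z_out: "z x \<le> \<epsilon>" if "c \<le> \<bar>x\<bar>" "\<bar>x\<bar> \<le> L" for x
  proof -
    have "cos (\<theta> * \<bar>x\<bar>) \<le> cos (\<theta> * c)"
      using that assms L \<theta> \<theta>_le[of "\<bar>x\<bar>"] by (intro cos_monotone_0_pi_le) auto
    then show ?thesis unfolding z_def cos_abs by (intro p(4)) auto
  qed
  have [measurable]: "p \<in> borel_measurable borel"
    by (intro borel_measurable_continuous_onI continuous_on_polymonial_function)
       (use p(1) in \<open>simp add: real_polynomial_function_eq\<close>)
  have [measurable]: "z \<in> borel_measurable borel" unfolding z_def by measurable
  define \<Psi> where "\<Psi> x = (\<Prod>j\<in>J. z (x j))" for x :: "'i \<Rightarrow> real"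
  have \<Psi>01: "0 \<le> \<Psi> x" "\<Psi> x \<le> 1" for x
    unfolding \<Psi>_def by (auto intro!: prod_nonneg prod_le_1 z01)
  have mV [measurable]: "(\<lambda>\<omega>. \<Psi> (\<lambda>j. V n j \<omega>)) \<in> borel_measurable M" for n
    unfolding \<Psi>_def by measurable
  have mX [measurable]: "(\<lambda>\<omega>. \<Psi> (\<lambda>j. X j \<omega>)) \<in> borel_measurable N"
    unfolding \<Psi>_def by measurable
  have iV: "integrable M (\<lambda>\<omega>. \<Psi> (\<lambda>j. V n j \<omega>))" for n
    by (rule M.integrable_const_bound[where B = 1]) (auto simp: \<Psi>01)
  have iX: "integrable N (\<lambda>\<omega>. \<Psi> (\<lambda>j. X j \<omega>))"
    by (rule N.integrable_const_bound[where B = 1]) (auto simp: \<Psi>01)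
  have "trig_sum J (\<lambda>x. complex_of_real (\<Psi> x))"
    unfolding \<Psi>_def z_def of_real_prod
    by (rule trig_sum_prod[OF J]) (rule trig_sum_real_polynomial[OF p(1) trig_sum_cos[OF J]])
  from trig_sum_integral_tendsto[OF M N V X lim this]
  have "(\<lambda>n. complex_of_real (\<integral>\<omega>. \<Psi> (\<lambda>j. V n j \<omega>) \<partial>M)) \<longlonglongrightarrow> of_real (\<integral>\<omega>. \<Psi> (\<lambda>j. X j \<omega>) \<partial>N)"
    by (simp add: integral_complex_of_real)
  then have "(\<lambda>n. \<integral>\<omega>. \<Psi> (\<lambda>j. V n j \<omega>) \<partial>M) \<longlonglongrightarrow> (\<integral>\<omega>. \<Psi> (\<lambda>j. X j \<omega>) \<partial>N)"
    by (simp add: tendsto_of_real_iff)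
  then have ev: "\<forall>\<^sub>F n in sequentially. (\<integral>\<omega>. \<Psi> (\<lambda>j. X j \<omega>) \<partial>N) - \<delta> / 4 < (\<integral>\<omega>. \<Psi> (\<lambda>j. V n j \<omega>) \<partial>M)"
    by (rule order_tendstoD) (use \<open>0 < \<delta>\<close> in simp)
  let ?A = "{\<omega> \<in> space N. \<forall>j\<in>J. \<bar>X j \<omega>\<bar> \<le> c'}"
  have A: "?A \<in> sets N" using J by measurable
  have low: "measure N ?A - \<delta> / 4 \<le> (\<integral>\<omega>. \<Psi> (\<lambda>j. X j \<omega>) \<partial>N)"
  proof -
    have "(1 - real (card J) * \<epsilon>) * indicator ?A \<omega> \<le> \<Psi> (\<lambda>j. X j \<omega>)" for \<omega>
    proof (cases "\<omega> \<in> ?A")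
      case True
      have "1 - real (card J) * \<epsilon> \<le> (1 - \<epsilon>) ^ card J"
        using Bernoulli_inequality[of "- \<epsilon>" "card J"] \<epsilon> by simp
      also have "\<dots> = (\<Prod>j\<in>J. 1 - \<epsilon>)" by simp
      also have "\<dots> \<le> \<Psi> (\<lambda>j. X j \<omega>)"
        unfolding \<Psi>_def using True \<epsilon> by (intro prod_mono) (auto intro: z_in)
      finally show ?thesis using True by simp
    qed (simp add: \<Psi>01)
    then have "(\<integral>\<omega>. (1 - real (card J) * \<epsilon>) * indicator ?A \<omega> \<partial>N) \<le> (\<integral>\<omega>. \<Psi> (\<lambda>j. X j \<omega>) \<partial>N)"
      using A by (intro integral_mono iX integrable_mult_right integrable_real_indicator)
        (auto simp: N.emeasure_eq_measure)
    then have "(1 - real (card J) * \<epsilon>) * measure N ?A \<le> (\<integral>\<omega>. \<Psi> (\<lambda>j. X j \<omega>) \<partial>N)"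
      using A by simp
    moreover have "real (card J) * \<epsilon> * measure N ?A \<le> real (card J) * \<epsilon> * 1"
      using \<epsilon> by (intro mult_left_mono) auto
    moreover have "real (card J) * \<epsilon> \<le> \<delta> / 4"
      using \<epsilon> by (simp add: algebra_simps)
    ultimately show ?thesis unfolding left_diff_distrib by linarith
  qed
  have up: "(\<integral>\<omega>. \<Psi> (\<lambda>j. V n j \<omega>) \<partial>M) \<le> measure M {\<omega> \<in> space M. \<forall>j\<in>J. \<bar>V n j \<omega>\<bar> < c} + \<delta> / 4" for n
  proof -
    let ?B = "{\<omega> \<in> space M. \<forall>j\<in>J. \<bar>V n j \<omega>\<bar> < c}"
    let ?C = "\<lambda>j. {\<omega> \<in> space M. L < \<bar>V n j \<omega>\<bar>}"
    have B: "?B \<in> sets M" using J by measurable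
    have C: "?C j \<in> sets M" if "j \<in> J" for j using that by measurable
    have "\<Psi> (\<lambda>j. V n j \<omega>) \<le> indicator ?B \<omega> + \<epsilon> + (\<Sum>j\<in>J. indicator (?C j) \<omega>)"
      if \<omega>: "\<omega> \<in> space M" for \<omega>
    proof -
      consider "\<omega> \<in> ?B" | j where "j \<in> J" "\<omega> \<in> ?C j"
        | j where "j \<in> J" "c \<le> \<bar>V n j \<omega>\<bar>" "\<bar>V n j \<omega>\<bar> \<le> L"
        using \<omega> by force
      then show ?thesis
      proof cases
        case 1
        have "0 \<le> (\<Sum>j\<in>J. indicator (?C j) \<omega> :: real)" by (intro sum_nonneg) auto
        with 1 \<Psi>01(2)[of "\<lambda>j. V n j \<omega>"] \<epsilon> show ?thesis by simp
      next
        case 2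
        have "(1::real) = indicator (?C j) \<omega>" using 2 by simp
        also have "\<dots> \<le> (\<Sum>j\<in>J. indicator (?C j) \<omega>)"
          using 2 J by (intro member_le_sum) auto
        finally show ?thesis using \<Psi>01(2)[of "\<lambda>j. V n j \<omega>"] \<epsilon>
          by (simp add: add_increasing)
      next
        case 3
        have "\<Psi> (\<lambda>j. V n j \<omega>) \<le> z (V n j \<omega>)"
          unfolding \<Psi>_def using J 3 z01 by (intro prod_le_factor) auto
        also have "\<dots> \<le> \<epsilon>" using 3 by (intro z_out)
        also have "\<dots> \<le> indicator ?B \<omega> + \<epsilon> + (\<Sum>j\<in>J. indicator (?C j) \<omega>)"
          by (auto intro!: add_increasing2 sum_nonneg)
        finally show ?thesis .
      qed
    qed
    then have "(\<integral>\<omega>. \<Psi> (\<lambda>j. V n j \<omega>) \<partial>M) \<le> (\<integral>\<omega>. indicator ?B \<omega> + \<epsilon> + (\<Sum>j\<in>J. indicator (?C j) \<omega>) \<partial>M)"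
      by (intro integral_mono iV) (auto intro!: Bochner_Integration.integrable_add Bochner_Integration.integrable_sum
          integrable_real_indicator B C simp: M.emeasure_eq_measure)
    also have "\<dots> = measure M ?B + \<epsilon> + (\<Sum>j\<in>J. measure M (?C j))"
      using B by (simp add: M.prob_space integrable_real_indicator M.emeasure_eq_measure C)
    also have "\<dots> \<le> measure M ?B + \<epsilon> + (\<Sum>j\<in>J. \<epsilon>)"
      by (intro add_left_mono sum_mono tightL)
    also have "\<dots> \<le> measure M ?B + \<delta> / 4"
      using \<epsilon> by (simp add: algebra_simps)
    finally show ?thesis .
  qed
  from ev show ?thesis
  proof eventually_elim
    case (elim n)
    with low up[of n] \<open>0 < \<delta>\<close> show ?case by simp
  qed
qed

section \<open>Suprema of continuous processes\<close>

definition dyadic_grid :: "nat \<Rightarrow> real set" where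
  "dyadic_grid m = (\<lambda>j. real j / 2 ^ m) ` {..2 ^ m}"

lemma finite_dyadic_grid [simp]: "finite (dyadic_grid m)"
  by (simp add: dyadic_grid_def)

lemma dyadic_grid_subset: "dyadic_grid m \<subseteq> {0..1}"
  by (auto simp: dyadic_grid_def field_simps simp flip: of_nat_power)

lemma incseq_dyadic_grid: "incseq dyadic_grid"
proof (rule incseq_SucI)
  fix m show "dyadic_grid m \<subseteq> dyadic_grid (Suc m)"
  proof
    fix x assume "x \<in> dyadic_grid m"
    then obtain j where "j \<le> 2 ^ m" "x = real j / 2 ^ m" by (auto simp: dyadic_grid_def)
    then have "2 * j \<in> {..2 ^ Suc m}" "x = real (2 * j) / 2 ^ Suc m" by auto
    then show "x \<in> dyadic_grid (Suc m)" unfolding dyadic_grid_def by blast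
  qed
qed

text \<open>Allowing \<open>j = 2 ^ m\<close> covers u = 1; the right neighbour then lies outside
  the unit interval.\<close>

lemma dyadic_floor:
  assumes "u \<in> {0..1}"
  obtains j where "j \<le> 2 ^ m" "real j / 2 ^ m \<le> u" "u < real (Suc j) / 2 ^ m"
proof
  let ?j = "nat \<lfloor>u * 2 ^ m\<rfloor>"
  have j: "real ?j = of_int \<lfloor>u * 2 ^ m\<rfloor>" using assms by simp
  have "real ?j \<le> u * 2 ^ m" unfolding j by simp
  moreover have "u * 2 ^ m \<le> 1 * 2 ^ m" using assms by (intro mult_right_mono) auto
  ultimately have "real ?j \<le> real (2 ^ m)" unfolding of_nat_power of_nat_numeral by linarith
  then show "?j \<le> 2 ^ m" by (simp only: of_nat_le_iff)
  show "real ?j / 2 ^ m \<le> u" using \<open>real ?j \<le> u * 2 ^ m\<close> by (simp add: field_simps)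
  have "u * 2 ^ m < real (Suc ?j)" using j by simp linarith
  then show "u < real (Suc ?j) / 2 ^ m" by (simp add: field_simps)
qed

lemma bounded_on_dyadic_grid:
  fixes f :: "real \<Rightarrow> real"
  assumes f: "continuous_on {0..1} f" and le: "\<And>m t. t \<in> dyadic_grid m \<Longrightarrow> \<bar>f t\<bar> \<le> c"
    and u: "u \<in> {0..1}"
  shows "\<bar>f u\<bar> \<le> c"
proof -
  have "\<exists>j. j \<le> 2 ^ m \<and> real j / 2 ^ m \<le> u \<and> u < real (Suc j) / 2 ^ m" for m :: nat
    using dyadic_floor[OF u, of m] by metis
  then obtain j where j: "\<And>m. j m \<le> 2 ^ m" "\<And>m. real (j m) / 2 ^ m \<le> u" "\<And>m. u < real (Suc (j m)) / 2 ^ m"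
    by metis
  define v where "v m = real (j m) / 2 ^ m" for m
  have v: "v m \<in> dyadic_grid m" for m using j(1) by (auto simp: v_def dyadic_grid_def)
  have "(\<lambda>m. v m) \<longlonglongrightarrow> u"
  proof (rule tendsto_sandwich[of "\<lambda>m. u - (1/2) ^ m" v sequentially "\<lambda>_. u" u])
    have "u - (1/2) ^ m \<le> v m" for m
      using j(3)[of m] unfolding v_def power_one_over by (simp add: add_divide_distrib)
    then show "\<forall>\<^sub>F m in sequentially. u - (1/2) ^ m \<le> v m" by simp
    show "\<forall>\<^sub>F m in sequentially. v m \<le> u" using j(2) by (simp add: v_def)
    have "(\<lambda>m. (1/2::real) ^ m) \<longlonglongrightarrow> 0" by (rule LIMSEQ_realpow_zero) auto
    from tendsto_diff[OF tendsto_const this] show "(\<lambda>m. u - (1/2) ^ m) \<longlonglongrightarrow> u" by simp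
  qed simp
  then have "(\<lambda>m. f (v m)) \<longlonglongrightarrow> f u"
    using u v dyadic_grid_subset
    by (intro continuous_on_tendsto_compose[OF f]) (blast intro!: always_eventually)+
  then have "(\<lambda>m. \<bar>f (v m)\<bar>) \<longlonglongrightarrow> \<bar>f u\<bar>" by (rule tendsto_rabs)
  then show ?thesis using le v by (intro LIMSEQ_le_const2) auto
qed

lemma sup_abs_le_iff:
  fixes f :: "real \<Rightarrow> real"
  assumes f: "continuous_on {0..1} f"
  shows "(SUP u\<in>{0..1}. \<bar>f u\<bar>) \<le> c \<longleftrightarrow> (\<forall>u\<in>{0..1}. \<bar>f u\<bar> \<le> c)"
proof -
  have "compact ((\<lambda>u. \<bar>f u\<bar>) ` {0..1})"
    by (intro compact_continuous_image continuous_intros f) auto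
  then have "bdd_above ((\<lambda>u. \<bar>f u\<bar>) ` {0..1})"
    by (intro bounded_imp_bdd_above compact_imp_bounded)
  then show ?thesis
    by (subst cSUP_le_iff) auto
qed

lemma sup_abs_attained:
  fixes f :: "real \<Rightarrow> real"
  assumes f: "continuous_on {0..1} f"
  obtains u where "u \<in> {0..1}" "\<bar>f u\<bar> = (SUP u\<in>{0..1}. \<bar>f u\<bar>)"
proof -
  obtain u where u: "u \<in> {0..1}" "\<And>v. v \<in> {0..1} \<Longrightarrow> \<bar>f v\<bar> \<le> \<bar>f u\<bar>"
    using continuous_attains_sup[of "{0..1::real}" "\<lambda>u. \<bar>f u\<bar>"] f
    by (force intro: continuous_intros)
  have "(SUP u\<in>{0..1}. \<bar>f u\<bar>) = \<bar>f u\<bar>"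
    using u by (intro cSup_eq_maximum) auto
  with u that show ?thesis by metis
qed

text \<open>Turns a condition on an uncountable supremum into one on nested finite grids; both
  measurability and the passage from finite-dimensional bounds to the supremum rest on it.\<close>

lemma sup_abs_le_iff_dyadic_grid:
  fixes f :: "real \<Rightarrow> real"
  assumes f: "continuous_on {0..1} f"
  shows "(SUP u\<in>{0..1}. \<bar>f u\<bar>) \<le> c \<longleftrightarrow> (\<forall>m. \<forall>t\<in>dyadic_grid m. \<bar>f t\<bar> \<le> c)"
  unfolding sup_abs_le_iff[OF f]
  using bounded_on_dyadic_grid[OF f] dyadic_grid_subset by blast

lemma sup_abs_measurable:
  fixes X :: "real \<Rightarrow> 'a \<Rightarrow> real"
  assumes X: "\<And>t. t \<in> {0..1} \<Longrightarrow> X t \<in> borel_measurable M"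
    and cont: "\<And>\<omega>. \<omega> \<in> space M \<Longrightarrow> continuous_on {0..1} (\<lambda>t. X t \<omega>)"
  shows "(\<lambda>\<omega>. SUP u\<in>{0..1}. \<bar>X u \<omega>\<bar>) \<in> borel_measurable M"
proof (rule borel_measurable_iff_le[THEN iffD2], intro allI)
  fix c
  have [measurable]: "t \<in> dyadic_grid m \<Longrightarrow> X t \<in> borel_measurable M" for t m
    using X dyadic_grid_subset by blast
  have "{\<omega> \<in> space M. (SUP u\<in>{0..1}. \<bar>X u \<omega>\<bar>) \<le> c} =
        {\<omega> \<in> space M. \<forall>m. \<forall>t\<in>dyadic_grid m. \<bar>X t \<omega>\<bar> \<le> c}"
    using sup_abs_le_iff_dyadic_grid[OF cont] by auto
  also have "\<dots> \<in> sets M" by measurable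
  finally show "{\<omega> \<in> space M. (SUP u\<in>{0..1}. \<bar>X u \<omega>\<bar>) \<le> c} \<in> sets M" .
qed

section \<open>Tightness of finitely many random variables\<close>

lemma tight_random_variable:
  fixes X :: "'a \<Rightarrow> real"
  assumes "prob_space M" and X [measurable]: "X \<in> borel_measurable M" and "0 < e"
  shows "\<exists>L. measure M {\<omega> \<in> space M. L < \<bar>X \<omega>\<bar>} \<le> e"
proof -
  interpret prob_space M by fact
  have "(\<lambda>n. prob {\<omega> \<in> space M. real n < \<bar>X \<omega>\<bar>}) \<longlonglongrightarrow> prob (\<Inter>n. {\<omega> \<in> space M. real n < \<bar>X \<omega>\<bar>})"
    by (intro finite_Lim_measure_decseq) (auto simp: decseq_def)
  moreover have "(\<Inter>n. {\<omega> \<in> space M. real n < \<bar>X \<omega>\<bar>}) = {}"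
    by auto (metis reals_Archimedean2 order_less_asym)
  ultimately have "\<forall>\<^sub>F n in sequentially. prob {\<omega> \<in> space M. real n < \<bar>X \<omega>\<bar>} < e"
    using \<open>0 < e\<close> by (intro order_tendstoD(2)) auto
  then show ?thesis
    using eventually_happens'[OF sequentially_bot] by (meson less_imp_le)
qed

lemma tight_random_vector:
  fixes X :: "'i \<Rightarrow> 'a \<Rightarrow> real"
  assumes M: "prob_space M" and J: "finite J"
    and X: "\<And>j. j \<in> J \<Longrightarrow> X j \<in> borel_measurable M" and "0 < e"
  shows "\<exists>L. \<forall>j\<in>J. measure M {\<omega> \<in> space M. L < \<bar>X j \<omega>\<bar>} \<le> e"
proof -
  interpret prob_space M by fact
  obtain l where l: "\<And>j. j \<in> J \<Longrightarrow> prob {\<omega> \<in> space M. l j < \<bar>X j \<omega>\<bar>} \<le> e"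
    using tight_random_variable[OF M X \<open>0 < e\<close>] by metis
  have "prob {\<omega> \<in> space M. Max (l ` J) < \<bar>X j \<omega>\<bar>} \<le> e" if "j \<in> J" for j
  proof -
    note [measurable] = X[OF that]
    have "l j \<le> Max (l ` J)" using J that by simp
    then have "prob {\<omega> \<in> space M. Max (l ` J) < \<bar>X j \<omega>\<bar>} \<le> prob {\<omega> \<in> space M. l j < \<bar>X j \<omega>\<bar>}"
      by (intro finite_measure_mono) auto
    with l[OF that] show ?thesis by simp
  qed
  then show ?thesis by blast
qed

text \<open>The finite-dimensional comparison is applied to a constant sequence. It loses a little,
  giving a level \<open>c'\<close> above \<open>c\<close>; refining the grid and then letting
  \<open>c'\<close> fall to \<open>c\<close>, each along decreasing events, recovers the closed
  band.\<close>

lemma prob_sup_abs_le_compare: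
  fixes V :: "real \<Rightarrow> 'a \<Rightarrow> real" and X :: "real \<Rightarrow> 'b \<Rightarrow> real"
  assumes M: "prob_space M" and N: "prob_space N"
    and V: "\<And>t. t \<in> {0..1} \<Longrightarrow> V t \<in> borel_measurable M"
    and X: "\<And>t. t \<in> {0..1} \<Longrightarrow> X t \<in> borel_measurable N"
    and contV: "\<And>\<omega>. \<omega> \<in> space M \<Longrightarrow> continuous_on {0..1} (\<lambda>t. V t \<omega>)"
    and contX: "\<And>\<omega>. \<omega> \<in> space N \<Longrightarrow> continuous_on {0..1} (\<lambda>t. X t \<omega>)"
    and cf: "\<And>S c. finite S \<Longrightarrow> S \<subseteq> {0..1} \<Longrightarrow>
      (\<integral>\<omega>. iexp (\<Sum>t\<in>S. c t * V t \<omega>) \<partial>M) = (\<integral>\<omega>. iexp (\<Sum>t\<in>S. c t * X t \<omega>) \<partial>N)"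
    and c: "0 \<le> c"
  shows "measure N {\<omega> \<in> space N. (SUP u\<in>{0..1}. \<bar>X u \<omega>\<bar>) \<le> c}
       \<le> measure M {\<omega> \<in> space M. (SUP u\<in>{0..1}. \<bar>V u \<omega>\<bar>) \<le> c}"
proof -
  interpret M: prob_space M by fact
  interpret N: prob_space N by fact
  let ?SX = "\<lambda>\<omega>. SUP u\<in>{0..1}. \<bar>X u \<omega>\<bar>" and ?SV = "\<lambda>\<omega>. SUP u\<in>{0..1}. \<bar>V u \<omega>\<bar>"
  note [measurable] = sup_abs_measurable[OF X contX] sup_abs_measurable[OF V contV]
  have dy: "t \<in> dyadic_grid m \<Longrightarrow> t \<in> {0..1}" for t m using dyadic_grid_subset by blast
  have [measurable]: "t \<in> dyadic_grid m \<Longrightarrow> X t \<in> borel_measurable N"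
     "t \<in> dyadic_grid m \<Longrightarrow> V t \<in> borel_measurable M" for t m
    using X V dy by blast+
  have step1: "measure N {\<omega> \<in> space N. ?SX \<omega> \<le> c} \<le> measure M {\<omega> \<in> space M. ?SV \<omega> \<le> c'}"
    if "c < c'" for c'
  proof -
    let ?A = "\<lambda>m. {\<omega> \<in> space M. \<forall>t\<in>dyadic_grid m. \<bar>V t \<omega>\<bar> \<le> c'}"
    have "measure N {\<omega> \<in> space N. ?SX \<omega> \<le> c} \<le> measure M (?A m)" for m
    proof (rule field_le_epsilon)
      fix \<delta> :: real assume "0 < \<delta>"
      have "\<forall>\<^sub>F n::nat in sequentially. measure N {\<omega> \<in> space N. \<forall>t\<in>dyadic_grid m. \<bar>X t \<omega>\<bar> \<le> c} - \<delta>
           \<le> measure M {\<omega> \<in> space M. \<forall>t\<in>dyadic_grid m. \<bar>V t \<omega>\<bar> < c'}"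
      proof (rule eventually_prob_all_abs_less[OF M N, where V = "\<lambda>_. V"])
        show "\<exists>L. \<forall>n::nat. \<forall>j\<in>dyadic_grid m. measure M {\<omega> \<in> space M. L < \<bar>V j \<omega>\<bar>} \<le> e"
          if "0 < e" for e
          using tight_random_vector[OF M, of "dyadic_grid m" V e] that by auto
        show "(\<lambda>n::nat. \<integral>\<omega>. iexp (\<Sum>j\<in>dyadic_grid m. d j * V j \<omega>) \<partial>M)
          \<longlonglongrightarrow> (\<integral>\<omega>. iexp (\<Sum>j\<in>dyadic_grid m. d j * X j \<omega>) \<partial>N)" for d
          using cf[of "dyadic_grid m" d] dyadic_grid_subset by simp
      qed (use that c \<open>0 < \<delta>\<close> in auto)
      then have "measure N {\<omega> \<in> space N. \<forall>t\<in>dyadic_grid m. \<bar>X t \<omega>\<bar> \<le> c} - \<delta>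
           \<le> measure M {\<omega> \<in> space M. \<forall>t\<in>dyadic_grid m. \<bar>V t \<omega>\<bar> < c'}"
        by simp
      also have "\<dots> \<le> measure M (?A m)"
        by (intro M.finite_measure_mono) (auto intro: less_imp_le)
      moreover have "measure N {\<omega> \<in> space N. ?SX \<omega> \<le> c} \<le> measure N {\<omega> \<in> space N. \<forall>t\<in>dyadic_grid m. \<bar>X t \<omega>\<bar> \<le> c}"
        by (intro N.finite_measure_mono) (auto simp: sup_abs_le_iff_dyadic_grid[OF contX])
      ultimately show "measure N {\<omega> \<in> space N. ?SX \<omega> \<le> c} \<le> measure M (?A m) + \<delta>"
        by linarith
    qed
    moreover have "(\<lambda>m. measure M (?A m)) \<longlonglongrightarrow> measure M (\<Inter>m. ?A m)"
    proof (rule M.finite_Lim_measure_decseq)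
      show "range ?A \<subseteq> sets M" by auto
      show "decseq ?A"
        using incseq_dyadic_grid unfolding decseq_def incseq_def by blast
    qed
    moreover have "(\<Inter>m. ?A m) = {\<omega> \<in> space M. ?SV \<omega> \<le> c'}"
      using sup_abs_le_iff_dyadic_grid[OF contV] by auto
    ultimately show ?thesis
      by (intro LIMSEQ_le_const[of "\<lambda>m. measure M (?A m)"]) auto
  qed
  let ?B = "\<lambda>k. {\<omega> \<in> space M. ?SV \<omega> \<le> c + 1 / real (Suc k)}"
  have "(\<lambda>k. measure M (?B k)) \<longlonglongrightarrow> measure M (\<Inter>k. ?B k)"
  proof (rule M.finite_Lim_measure_decseq)
    show "range ?B \<subseteq> sets M" by auto
    show "decseq ?B"
    proof (rule decseq_SucI)
      fix k
      have "1 / real (Suc (Suc k)) \<le> 1 / real (Suc k)" by (simp add: field_simps)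
      then show "?B (Suc k) \<subseteq> ?B k" by force
    qed
  qed
  moreover have "(\<Inter>k. ?B k) = {\<omega> \<in> space M. ?SV \<omega> \<le> c}"
  proof (intro set_eqI iffI)
    fix \<omega> assume *: "\<omega> \<in> (\<Inter>k. ?B k)"
    have "(\<lambda>k. c + 1 / real (Suc k)) \<longlonglongrightarrow> c + 0"
      by (intro tendsto_add tendsto_const LIMSEQ_Suc lim_const_over_n)
    then have "?SV \<omega> \<le> c"
      using * by (intro LIMSEQ_le_const[of "\<lambda>k. c + 1 / real (Suc k)"]) auto
    with * show "\<omega> \<in> {\<omega> \<in> space M. ?SV \<omega> \<le> c}" by auto
  next
    fix \<omega> assume *: "\<omega> \<in> {\<omega> \<in> space M. ?SV \<omega> \<le> c}"
    have "?SV \<omega> \<le> c + 1 / real (Suc k)" for k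
      using * by (auto intro: add_increasing2)
    with * show "\<omega> \<in> (\<Inter>k. ?B k)" by auto
  qed
  ultimately show ?thesis
    using step1 by (intro LIMSEQ_le_const[of "\<lambda>k. measure M (?B k)"]) auto
qed

text \<open>Of three distinct points in a linear order, one lies between the other two.\<close>

lemma finite_if_no_middle:
  fixes A :: "'a :: linorder set"
  assumes "\<And>x y z. x \<in> A \<Longrightarrow> y \<in> A \<Longrightarrow> z \<in> A \<Longrightarrow> x < y \<Longrightarrow> y < z \<Longrightarrow> False"
  shows "finite A"
proof (rule ccontr)
  assume "infinite A"
  then obtain B where B: "B \<subseteq> A" "card B = 3"
    using infinite_arbitrarily_large[of A 3] by blast
  then obtain x y z where "x \<in> A" "y \<in> A" "z \<in> A" "x \<noteq> y" "y \<noteq> z" "x \<noteq> z"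
    by (auto simp: card_3_iff)
  then show False
    using assms by (metis linorder_neqE)
qed

section \<open>The Brownian bridge\<close>

text \<open>Serves the degenerate case of \<open>gaussian_law\<close>, which does occur: the bridge
  has variance 0 at both endpoints.\<close>

lemma distr_return_integral:
  fixes f :: "real \<Rightarrow> 'c :: {banach, second_countable_topology}"
  assumes [measurable]: "X \<in> borel_measurable W" "f \<in> borel_measurable borel"
    and "prob_space W" "distr W borel X = return borel \<mu>"
  shows "integrable W (\<lambda>\<omega>. f (X \<omega>))" "(\<integral>\<omega>. f (X \<omega>) \<partial>W) = f \<mu>"
proof -
  interpret prob_space W by fact
  have "AE x in distr W borel X. x = \<mu>"
    unfolding assms(4) by (simp add: AE_return)
  then have ae: "AE \<omega> in W. X \<omega> = \<mu>"
    by (subst (asm) AE_distr_iff) auto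
  have "integrable W (\<lambda>\<omega>. f (X \<omega>)) \<longleftrightarrow> integrable W (\<lambda>\<omega>. f \<mu>)"
    by (rule integrable_cong_AE) (use ae in auto)
  then show "integrable W (\<lambda>\<omega>. f (X \<omega>))" by simp
  have "(\<integral>\<omega>. f (X \<omega>) \<partial>W) = (\<integral>\<omega>. f \<mu> \<partial>W)"
    by (rule integral_cong_AE) (use ae in auto)
  then show "(\<integral>\<omega>. f (X \<omega>) \<partial>W) = f \<mu>" by (simp add: prob_space)
qed

text \<open>Frequency 1 is enough, since any other can be absorbed into the coefficients of the
  linear combinations to which this is applied.\<close>

lemma gaussian_law_cf:
  assumes W: "prob_space W" and X [measurable]: "X \<in> borel_measurable W"
    and gauss: "gaussian_law (distr W borel X)"
  shows "integrable W X" and "integrable W (\<lambda>\<omega>. (X \<omega>)\<^sup>2)"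
    and "(\<integral>\<omega>. X \<omega> \<partial>W) = 0 \<Longrightarrow>
           (\<integral>\<omega>. iexp (X \<omega>) \<partial>W) = of_real (exp (- (\<integral>\<omega>. (X \<omega>)\<^sup>2 \<partial>W) / 2))"
proof -
  interpret prob_space W by fact
  have "integrable W (\<lambda>\<omega>. (X \<omega>)\<^sup>2) \<and> ((\<integral>\<omega>. X \<omega> \<partial>W) = 0 \<longrightarrow>
           (\<integral>\<omega>. iexp (X \<omega>) \<partial>W) = of_real (exp (- (\<integral>\<omega>. (X \<omega>)\<^sup>2 \<partial>W) / 2)))"
    using gauss unfolding gaussian_law_def
  proof (elim disjE exE conjE)
    fix \<mu> \<sigma> :: real
    assume \<sigma>: "0 < \<sigma>" and eq: "distr W borel X = density lborel (\<lambda>x. ennreal (normal_density \<mu> \<sigma> x))"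
    have "distr W lborel X = distr W borel X"
      by (rule distr_cong) auto
    then have D: "distributed W lborel X (normal_density \<mu> \<sigma>)"
      unfolding distributed_def using eq by auto
    have "integrable lborel (\<lambda>x. normal_density \<mu> \<sigma> x * (x - \<mu>)\<^sup>2)"
      by (rule integrable_normal_moment) fact
    then have "integrable (distr W borel X) (\<lambda>x. (x - \<mu>)\<^sup>2)"
      unfolding eq by (subst integrable_density) auto
    then have sq: "integrable W (\<lambda>\<omega>. (X \<omega> - \<mu>)\<^sup>2)"
      by (subst (asm) integrable_distr_eq) auto
    then have int: "integrable W (\<lambda>\<omega>. X \<omega> - \<mu>)"
      by (rule square_integrable_imp_integrable[rotated]) auto
    have "integrable W (\<lambda>\<omega>. (X \<omega> - \<mu>)\<^sup>2 + 2 * \<mu> * (X \<omega> - \<mu>) + \<mu>\<^sup>2)"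
      by (intro Bochner_Integration.integrable_add integrable_mult_right sq int) auto
    then have "integrable W (\<lambda>\<omega>. (X \<omega>)\<^sup>2)"
      by (simp add: power2_eq_square algebra_simps)
    moreover {
      assume 0: "(\<integral>\<omega>. X \<omega> \<partial>W) = 0"
      with normal_distributed_expectation[OF \<sigma> D] have "\<mu> = 0" by simp
      with normal_distributed_variance[OF \<sigma> D] 0 have var: "(\<integral>\<omega>. (X \<omega>)\<^sup>2 \<partial>W) = \<sigma>\<^sup>2" by simp
      have "distributed W lborel (\<lambda>\<omega>. X \<omega> / \<sigma>) std_normal_density"
        using normal_standard_normal_convert[OF \<sigma>, of X \<mu>] D \<open>\<mu> = 0\<close> by simp
      then have std: "distr W lborel (\<lambda>\<omega>. X \<omega> / \<sigma>) = std_normal_distribution"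
        by (rule distributed_distr_eq_density)
      have "(\<integral>\<omega>. iexp (X \<omega>) \<partial>W) = (\<integral>\<omega>. iexp (\<sigma> * (X \<omega> / \<sigma>)) \<partial>W)"
        using \<sigma> by simp
      also have "\<dots> = (\<integral>x. iexp (\<sigma> * x) \<partial>distr W lborel (\<lambda>\<omega>. X \<omega> / \<sigma>))"
        by (subst integral_distr) auto
      also have "\<dots> = char std_normal_distribution \<sigma>"
        unfolding std char_def ..
      also have "\<dots> = of_real (exp (- (\<sigma>\<^sup>2) / 2))"
        by (simp add: char_std_normal_distribution)
      finally have "(\<integral>\<omega>. iexp (X \<omega>) \<partial>W) = of_real (exp (- (\<integral>\<omega>. (X \<omega>)\<^sup>2 \<partial>W) / 2))"
        unfolding var .
    }
    ultimately show ?thesis by blast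
  next
    fix \<mu> assume eq: "distr W borel X = return borel \<mu>"
    note R = distr_return_integral[OF X _ W eq]
    have "(\<integral>\<omega>. X \<omega> \<partial>W) = \<mu>" using R(2)[of "\<lambda>x. x"] by simp
    moreover have "(\<integral>\<omega>. (X \<omega>)\<^sup>2 \<partial>W) = \<mu>\<^sup>2" using R(2)[of "\<lambda>x. x\<^sup>2"] by simp
    moreover have "(\<integral>\<omega>. iexp (X \<omega>) \<partial>W) = iexp \<mu>" by (rule R(2)) simp
    moreover have "integrable W (\<lambda>\<omega>. (X \<omega>)\<^sup>2)" using R(1)[of "\<lambda>x. x\<^sup>2"] by simp
    ultimately show ?thesis by simp
  qed
  then show sq: "integrable W (\<lambda>\<omega>. (X \<omega>)\<^sup>2)"
    and "(\<integral>\<omega>. X \<omega> \<partial>W) = 0 \<Longrightarrow>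
           (\<integral>\<omega>. iexp (X \<omega>) \<partial>W) = of_real (exp (- (\<integral>\<omega>. (X \<omega>)\<^sup>2 \<partial>W) / 2))"
    by auto
  from sq show "integrable W X"
    by (rule square_integrable_imp_integrable[rotated]) auto
qed

text \<open>The variance of the combination of bridge values with coefficients \<open>c\<close>. The
  centred indicators of the empirical process have the same covariance, so this one form describes
  the characteristic functions on both sides.\<close>

definition bridge_form :: "real set \<Rightarrow> (real \<Rightarrow> real) \<Rightarrow> real" where
  "bridge_form S c = (\<Sum>s\<in>S. \<Sum>t\<in>S. c s * c t * (min s t - s * t))"

lemma sum_mult_eq_double_sum:
  fixes f :: "'a \<Rightarrow> real"
  shows "(\<Sum>s\<in>S. c s * f s)\<^sup>2 = (\<Sum>s\<in>S. \<Sum>t\<in>S. c s * c t * (f s * f t))"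
  by (simp add: power2_eq_square sum_product ac_simps)

locale bridge =
  fixes W :: "'w measure" and BB :: "real \<Rightarrow> 'w \<Rightarrow> real"
  assumes bridge: "brownian_bridge W BB"

sublocale bridge \<subseteq> prob_space W
  using bridge by (auto simp: brownian_bridge_def)

context bridge
begin

lemma BB_measurable [measurable]: "t \<in> {0..1} \<Longrightarrow> BB t \<in> borel_measurable W"
  using bridge by (auto simp: brownian_bridge_def gaussian_process_def)

lemma BB_continuous: "\<omega> \<in> space W \<Longrightarrow> continuous_on {0..1} (\<lambda>t. BB t \<omega>)"
  using bridge by (auto simp: brownian_bridge_def)

lemma BB_expectation: "t \<in> {0..1} \<Longrightarrow> expectation (BB t) = 0"
  using bridge by (auto simp: brownian_bridge_def)

lemma BB_covariance:
  "s \<in> {0..1} \<Longrightarrow> t \<in> {0..1} \<Longrightarrow> expectation (\<lambda>\<omega>. BB s \<omega> * BB t \<omega>) = min s t - s * t"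
  using bridge by (auto simp: brownian_bridge_def)

lemma BB_gaussian:
  assumes "finite S" "S \<subseteq> {0..1}"
  shows "gaussian_law (distr W borel (\<lambda>\<omega>. \<Sum>t\<in>S. c t * BB t \<omega>))"
  using bridge assms unfolding brownian_bridge_def gaussian_process_def by blast

lemma BB_integrable:
  assumes "t \<in> {0..1}"
  shows "integrable W (BB t)" "integrable W (\<lambda>\<omega>. (BB t \<omega>)\<^sup>2)"
proof -
  have "gaussian_law (distr W borel (BB t))"
    using BB_gaussian[of "{t}" "\<lambda>_. 1"] assms by simp
  from gaussian_law_cf(1,2)[OF prob_space_axioms BB_measurable[OF assms] this]
  show "integrable W (BB t)" "integrable W (\<lambda>\<omega>. (BB t \<omega>)\<^sup>2)" .
qed

lemma BB_integrable_mult: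
  assumes "s \<in> {0..1}" "t \<in> {0..1}"
  shows "integrable W (\<lambda>\<omega>. BB s \<omega> * BB t \<omega>)"
proof (rule Bochner_Integration.integrable_bound)
  show "integrable W (\<lambda>\<omega>. (BB s \<omega>)\<^sup>2 + (BB t \<omega>)\<^sup>2)"
    using assms by (intro Bochner_Integration.integrable_add BB_integrable)
  have "\<bar>x * y\<bar> \<le> x\<^sup>2 + y\<^sup>2" for x y :: real
  proof -
    have "0 \<le> (\<bar>x\<bar> - \<bar>y\<bar>)\<^sup>2 + (x\<^sup>2 + y\<^sup>2)" by simp
    then show ?thesis by (simp add: power2_diff abs_mult)
  qed
  then show "AE \<omega> in W. norm (BB s \<omega> * BB t \<omega>) \<le> norm ((BB s \<omega>)\<^sup>2 + (BB t \<omega>)\<^sup>2)"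
    by simp
qed (use assms in measurable)

lemma BB_sum:
  assumes "finite S" "S \<subseteq> {0..1}"
  shows "expectation (\<lambda>\<omega>. \<Sum>t\<in>S. c t * BB t \<omega>) = 0"
    and "expectation (\<lambda>\<omega>. (\<Sum>t\<in>S. c t * BB t \<omega>)\<^sup>2) = bridge_form S c"
    and "integrable W (\<lambda>\<omega>. (\<Sum>t\<in>S. c t * BB t \<omega>)\<^sup>2)"
    and "expectation (\<lambda>\<omega>. iexp (\<Sum>t\<in>S. c t * BB t \<omega>)) =
           of_real (exp (- expectation (\<lambda>\<omega>. (\<Sum>t\<in>S. c t * BB t \<omega>)\<^sup>2) / 2))"
proof -
  have in01: "t \<in> S \<Longrightarrow> t \<in> {0..1}" for t using assms by auto
  have [measurable]: "t \<in> S \<Longrightarrow> BB t \<in> borel_measurable W" for t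
    using assms by (intro BB_measurable) auto
  have "expectation (\<lambda>\<omega>. \<Sum>t\<in>S. c t * BB t \<omega>) = (\<Sum>t\<in>S. c t * expectation (BB t))"
    using assms by (subst Bochner_Integration.integral_sum) (auto intro!: BB_integrable)
  then show 0: "expectation (\<lambda>\<omega>. \<Sum>t\<in>S. c t * BB t \<omega>) = 0"
    using BB_expectation[OF in01] by simp
  show "expectation (\<lambda>\<omega>. (\<Sum>t\<in>S. c t * BB t \<omega>)\<^sup>2) = bridge_form S c"
  proof -
    have int: "integrable W (\<lambda>\<omega>. c s * c t * (BB s \<omega> * BB t \<omega>))" if "s \<in> S" "t \<in> S" for s t
      by (intro integrable_mult_right BB_integrable_mult in01 that)
    have "expectation (\<lambda>\<omega>. (\<Sum>t\<in>S. c t * BB t \<omega>)\<^sup>2) =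
        (\<Sum>s\<in>S. \<Sum>t\<in>S. expectation (\<lambda>\<omega>. c s * c t * (BB s \<omega> * BB t \<omega>)))"
      unfolding sum_mult_eq_double_sum using int
      by (simp add: Bochner_Integration.integral_sum Bochner_Integration.integrable_sum
          del: integral_mult_right_zero integrable_mult_right_iff cong: sum.cong)
    also have "\<dots> = bridge_form S c"
      unfolding bridge_form_def using BB_covariance[OF in01 in01]
      by (intro sum.cong refl) simp
    finally show ?thesis .
  qed
  have meas: "(\<lambda>\<omega>. \<Sum>t\<in>S. c t * BB t \<omega>) \<in> borel_measurable W" by measurable
  note G = gaussian_law_cf[OF prob_space_axioms meas BB_gaussian[OF assms]]
  show "integrable W (\<lambda>\<omega>. (\<Sum>t\<in>S. c t * BB t \<omega>)\<^sup>2)" by (rule G(2))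
  show "expectation (\<lambda>\<omega>. iexp (\<Sum>t\<in>S. c t * BB t \<omega>)) =
           of_real (exp (- expectation (\<lambda>\<omega>. (\<Sum>t\<in>S. c t * BB t \<omega>)\<^sup>2) / 2))"
    by (rule G(3)[OF 0])
qed

text \<open>A bridge whose component along its value at \<open>1/2\<close> is an independent Gaussian coordinate of
  the sample space.\<close>

definition resampled :: "real \<Rightarrow> 'w \<times> real \<Rightarrow> real" where
  "resampled t p = BB t (fst p) - 2 * min t (1 - t) * BB (1/2) (fst p) + min t (1 - t) * snd p"

abbreviation resample_space :: "('w \<times> real) measure" where
  "resample_space \<equiv> W \<Otimes>\<^sub>M std_normal_distribution"

lemma prob_space_resample: "prob_space resample_space"
proof -
  interpret N: prob_space std_normal_distribution
    by (rule prob_space_normal_density) simp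
  interpret pair_prob_space W std_normal_distribution ..
  show ?thesis by unfold_locales
qed

lemma resampled_measurable [measurable]:
  "t \<in> {0..1} \<Longrightarrow> resampled t \<in> borel_measurable resample_space"
proof -
  assume [measurable]: "t \<in> {0..1}"
  have h: "(1/2::real) \<in> {0..1}" by simp
  note [measurable] = BB_measurable[OF h]
  have [measurable]: "snd \<in> borel_measurable resample_space"
    using measurable_snd[of W std_normal_distribution] by simp
  show ?thesis unfolding resampled_def[abs_def] by measurable
qed

lemma resampled_continuous:
  "p \<in> space resample_space \<Longrightarrow> continuous_on {0..1} (\<lambda>t. resampled t p)"
  unfolding resampled_def
  by (intro continuous_intros BB_continuous) (auto simp: space_pair_measure)

text \<open>The covariance of \<open>BB t\<close> with \<open>BB (1/2)\<close> is
  \<open>min t (1 - t) / 2\<close>, and \<open>BB (1/2)\<close> has variance 1/4, so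
  \<open>2 * min t (1 - t)\<close> is the regression coefficient on the midpoint value. Removing the
  regression lowers the variance of the combination by \<open>m\<^sup>2\<close>, and the independent
  normal term \<open>m * z\<close> puts \<open>m\<^sup>2\<close> back; z/2 plays the part of the
  midpoint value.\<close>

lemma resampled_cf:
  assumes S: "finite S" "S \<subseteq> {0..1}"
  shows "(\<integral>p. iexp (\<Sum>t\<in>S. c t * resampled t p) \<partial>resample_space) =
         expectation (\<lambda>\<omega>. iexp (\<Sum>t\<in>S. c t * BB t \<omega>))"
proof -
  interpret N: prob_space std_normal_distribution
    by (rule prob_space_normal_density) simp
  interpret P: pair_prob_space W std_normal_distribution ..
  define m where "m = (\<Sum>t\<in>S. c t * min t (1 - t))"
  define A where "A \<omega> = (\<Sum>t\<in>S. c t * BB t \<omega>)" for \<omega>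
  define B where "B = BB (1/2)"
  have in01: "t \<in> S \<Longrightarrow> t \<in> {0..1}" for t using S by auto
  have [measurable]: "t \<in> S \<Longrightarrow> BB t \<in> borel_measurable W" for t
    using in01 by (intro BB_measurable) auto
  have mA [measurable]: "A \<in> borel_measurable W" unfolding A_def by measurable
  have mB [measurable]: "B \<in> borel_measurable W" unfolding B_def by simp
  have AB: "integrable W (\<lambda>\<omega>. A \<omega> * B \<omega>)" "expectation (\<lambda>\<omega>. A \<omega> * B \<omega>) = m / 2"
  proof -
    have *: "(\<lambda>\<omega>. A \<omega> * B \<omega>) = (\<lambda>\<omega>. \<Sum>t\<in>S. c t * (BB t \<omega> * BB (1/2) \<omega>))"
      by (simp add: A_def B_def sum_distrib_right mult.assoc)
    have int: "integrable W (\<lambda>\<omega>. c t * (BB t \<omega> * BB (1/2) \<omega>))" if "t \<in> S" for t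
      using in01[OF that] by (intro integrable_mult_right BB_integrable_mult) auto
    then show "integrable W (\<lambda>\<omega>. A \<omega> * B \<omega>)" unfolding * by auto
    have "expectation (\<lambda>\<omega>. A \<omega> * B \<omega>) = (\<Sum>t\<in>S. c t * (min t (1/2) - t * (1/2)))"
      unfolding * using int BB_covariance[OF in01, of _ "1/2"] by simp
    also have "\<dots> = (\<Sum>t\<in>S. c t * (min t (1 - t) / 2))"
      by (intro sum.cong refl arg_cong2[of _ _ _ _ "(*)"]) (auto simp: min_def)
    finally show "expectation (\<lambda>\<omega>. A \<omega> * B \<omega>) = m / 2"
      by (simp add: m_def sum_divide_distrib)
  qed
  have BBm: "integrable W (\<lambda>\<omega>. (B \<omega>)\<^sup>2)" "expectation (\<lambda>\<omega>. (B \<omega>)\<^sup>2) = 1/4"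
    using BB_integrable(2)[of "1/2"] BB_covariance[of "1/2" "1/2"]
    by (auto simp: B_def power2_eq_square)
  have AA: "integrable W (\<lambda>\<omega>. (A \<omega>)\<^sup>2)"
    using BB_sum(3)[OF S] by (simp add: A_def)
  \<comment> \<open>The time 1/2 may or may not belong to \<open>S\<close> already, so its two
    contributions are kept as separate terms.\<close>
  define d where "d t = (if t \<in> S then c t else 0) - (if t = 1/2 then 2 * m else 0)" for t
  have d: "(\<Sum>t\<in>insert (1/2) S. d t * BB t \<omega>) = A \<omega> - 2 * m * B \<omega>" for \<omega>
  proof -
    have "(\<Sum>t\<in>insert (1/2) S. d t * BB t \<omega>) =
      (\<Sum>t\<in>insert (1/2) S. (if t \<in> S then c t * BB t \<omega> else 0)) -
      (\<Sum>t\<in>insert (1/2) S. (if t = 1/2 then 2 * m * BB t \<omega> else 0))"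
      unfolding d_def sum_subtractf[symmetric] by (intro sum.cong) (auto simp: left_diff_distrib)
    also have "(\<Sum>t\<in>insert (1/2) S. (if t \<in> S then c t * BB t \<omega> else 0)) = A \<omega>"
      unfolding A_def using S by (intro sum.mono_neutral_cong_right) auto
    also have "(\<Sum>t\<in>insert (1/2) S. (if t = 1/2 then 2 * m * BB t \<omega> else 0)) = 2 * m * B \<omega>"
      using S by (subst sum.delta) (auto simp: B_def)
    finally show ?thesis .
  qed
  have "expectation (\<lambda>\<omega>. (A \<omega> - 2 * m * B \<omega>)\<^sup>2) =
      expectation (\<lambda>\<omega>. (A \<omega>)\<^sup>2 - 4 * m * (A \<omega> * B \<omega>) + 4 * m\<^sup>2 * (B \<omega>)\<^sup>2)"
    by (intro Bochner_Integration.integral_cong) (auto simp: power2_eq_square algebra_simps)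
  also have "\<dots> = expectation (\<lambda>\<omega>. (A \<omega>)\<^sup>2) - 4 * m * (m / 2) + 4 * m\<^sup>2 * (1/4)"
    by (simp add: AA AB BBm)
  finally have var: "expectation (\<lambda>\<omega>. (A \<omega> - 2 * m * B \<omega>)\<^sup>2) = expectation (\<lambda>\<omega>. (A \<omega>)\<^sup>2) - m\<^sup>2"
    by (simp add: power2_eq_square)
  have cfX: "expectation (\<lambda>\<omega>. iexp (A \<omega> - 2 * m * B \<omega>)) =
      of_real (exp (- (expectation (\<lambda>\<omega>. (A \<omega>)\<^sup>2) - m\<^sup>2) / 2))"
    using BB_sum(4)[of "insert (1/2) S" d] S unfolding d var by simp
  have sum_eq: "(\<Sum>t\<in>S. c t * resampled t (\<omega>, z)) = (A \<omega> - 2 * m * B \<omega>) + m * z" for \<omega> z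
    by (simp add: resampled_def A_def B_def m_def algebra_simps sum.distrib sum_subtractf
        sum_distrib_left sum_distrib_right)
  have [measurable]: "t \<in> S \<Longrightarrow> resampled t \<in> borel_measurable resample_space" for t
    using in01 by (intro resampled_measurable) auto
  have int: "integrable resample_space (\<lambda>p. iexp (\<Sum>t\<in>S. c t * resampled t p))"
    by (intro P.integrable_iexp) auto
  have "(\<integral>p. iexp (\<Sum>t\<in>S. c t * resampled t p) \<partial>resample_space) =
      (\<integral>\<omega>. (\<integral>z. iexp (\<Sum>t\<in>S. c t * resampled t (\<omega>, z)) \<partial>std_normal_distribution) \<partial>W)"
    by (rule P.integral_fst'[OF int, symmetric])
  also have "\<dots> = (\<integral>\<omega>. (\<integral>z. iexp (A \<omega> - 2 * m * B \<omega>) * iexp (m * z) \<partial>std_normal_distribution) \<partial>W)"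
    unfolding sum_eq by (simp add: distrib_left exp_add)
  also have "\<dots> = (\<integral>\<omega>. iexp (A \<omega> - 2 * m * B \<omega>) * char std_normal_distribution m \<partial>W)"
    unfolding char_def by simp
  also have "\<dots> = expectation (\<lambda>\<omega>. iexp (A \<omega> - 2 * m * B \<omega>)) * char std_normal_distribution m"
    by simp
  also have "\<dots> = of_real (exp (- (expectation (\<lambda>\<omega>. (A \<omega>)\<^sup>2) - m\<^sup>2) / 2) * exp (- (m\<^sup>2) / 2))"
    unfolding cfX by (simp add: char_std_normal_distribution)
  also have "\<dots> = of_real (exp (- expectation (\<lambda>\<omega>. (A \<omega>)\<^sup>2) / 2))"
    by (simp add: field_simps flip: exp_add)
  also have "\<dots> = expectation (\<lambda>\<omega>. iexp (\<Sum>t\<in>S. c t * BB t \<omega>))"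
    unfolding BB_sum(4)[OF S] A_def ..
  finally show ?thesis .
qed

end

context bridge
begin

lemma resampled_endpoints:
  assumes "BB 0 (fst p) = 0" "BB 1 (fst p) = 0"
  shows "resampled 0 p = 0" "resampled 1 p = 0"
  using assms by (auto simp: resampled_def)

text \<open>Where the supremum at \<open>z2\<close> is attained, the path is strictly monotone in the Gaussian
  coordinate, so the supremum exceeds \<open>q\<close> on one side of \<open>z2\<close>.\<close>

lemma finite_resampled_level:
  assumes \<omega>: "\<omega> \<in> space W" and end0: "BB 0 \<omega> = 0" "BB 1 \<omega> = 0" and q: "0 < q"
  shows "finite {z. (SUP u\<in>{0..1}. \<bar>resampled u (\<omega>, z)\<bar>) = q}"
proof (rule finite_if_no_middle)
  have cont: "continuous_on {0..1} (\<lambda>u. resampled u (\<omega>, z))" for z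
    by (rule resampled_continuous) (simp add: space_pair_measure \<omega>)
  fix z1 z2 z3
  assume A: "z1 \<in> {z. (SUP u\<in>{0..1}. \<bar>resampled u (\<omega>, z)\<bar>) = q}"
    "z2 \<in> {z. (SUP u\<in>{0..1}. \<bar>resampled u (\<omega>, z)\<bar>) = q}"
    "z3 \<in> {z. (SUP u\<in>{0..1}. \<bar>resampled u (\<omega>, z)\<bar>) = q}"
    and z: "z1 < z2" "z2 < z3"
  obtain u where u: "u \<in> {0..1}" "\<bar>resampled u (\<omega>, z2)\<bar> = q"
    using sup_abs_attained[OF cont[of z2]] A by auto
  \<comment> \<open>The coefficient \<open>min u (1 - u)\<close> of the Gaussian coordinate vanishes
    only at the endpoints, where the path is 0 and cannot attain a positive level.\<close>
  have "u \<noteq> 0" "u \<noteq> 1"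
    using u(2) resampled_endpoints[of "(\<omega>, z2)"] end0 q by auto
  with u have g: "0 < min u (1 - u)" by auto
  have diff: "resampled u (\<omega>, z) - resampled u (\<omega>, z2) = min u (1 - u) * (z - z2)" for z
    by (simp add: resampled_def right_diff_distrib)
  have up: "resampled u (\<omega>, z2) < resampled u (\<omega>, z3)"
    using diff[of z3] g z mult_pos_pos[of "min u (1 - u)" "z3 - z2"] by linarith
  have down: "resampled u (\<omega>, z1) < resampled u (\<omega>, z2)"
    using diff[of z1] g z mult_pos_neg[of "min u (1 - u)" "z1 - z2"] by linarith
  have "\<bar>resampled u (\<omega>, z1)\<bar> \<le> q" "\<bar>resampled u (\<omega>, z3)\<bar> \<le> q"
    using A u(1) sup_abs_le_iff[OF cont, of z1 q] sup_abs_le_iff[OF cont, of z3 q] by auto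
  with up down u(2) show False by linarith
qed

text \<open>The definition of the bridge prescribes moments at the endpoints, not values; variance 0
  gives vanishing almost surely.\<close>

lemma AE_bridge_endpoints: "AE \<omega> in W. BB 0 \<omega> = 0 \<and> BB 1 \<omega> = 0"
proof -
  have "AE \<omega> in W. BB t \<omega> = 0" if "t \<in> {0, 1}" for t
  proof -
    have t: "t \<in> {0..1}" using that by auto
    have "expectation (\<lambda>\<omega>. (BB t \<omega>)\<^sup>2) = 0"
      using BB_covariance[OF t t] that by (auto simp: power2_eq_square)
    then have "AE \<omega> in W. (BB t \<omega>)\<^sup>2 = 0"
      using BB_integrable(2)[OF t] by (subst (asm) integral_nonneg_eq_0_iff_AE) auto
    then show ?thesis by simp
  qed
  then show ?thesis by simp
qed

lemma AE_std_normal_finite: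
  fixes A :: "real set"
  assumes "finite A"
  shows "AE z in std_normal_distribution. z \<notin> A"
proof -
  have "AE z in lborel. z \<notin> A"
    by (intro AE_not_in finite_imp_null_set_lborel assms)
  then show ?thesis
    by (subst AE_density) auto
qed

text \<open>By Fubini: almost every section in the Gaussian coordinate is finite, hence
  null.\<close>

lemma AE_resampled_sup_neq:
  assumes "0 < q"
  shows "AE p in resample_space. (SUP u\<in>{0..1}. \<bar>resampled u p\<bar>) \<noteq> q"
proof -
  interpret N: prob_space std_normal_distribution
    by (rule prob_space_normal_density) simp
  interpret P: pair_prob_space W std_normal_distribution ..
  note [measurable] = sup_abs_measurable[OF resampled_measurable resampled_continuous]
  show ?thesis
  proof (rule P.AE_pair_measure)
    show "{p \<in> space resample_space. (SUP u\<in>{0..1}. \<bar>resampled u p\<bar>) \<noteq> q} \<in> sets resample_space"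
      by measurable
    show "AE \<omega> in W. AE z in std_normal_distribution. (SUP u\<in>{0..1}. \<bar>resampled u (\<omega>, z)\<bar>) \<noteq> q"
      using AE_bridge_endpoints AE_space
    proof eventually_elim
      case (elim \<omega>)
      from AE_std_normal_finite[OF finite_resampled_level[of \<omega> q]] elim assms
      show ?case by auto
    qed
  qed
qed

text \<open>At time 1/2 the resampled path equals z/2, which is almost surely nonzero. This excludes
  the quantile 0, a level to which the finiteness argument does not apply.\<close>

lemma AE_resampled_sup_pos: "AE p in resample_space. 0 < (SUP u\<in>{0..1}. \<bar>resampled u p\<bar>)"
proof -
  interpret N: prob_space std_normal_distribution
    by (rule prob_space_normal_density) simp
  interpret P: pair_prob_space W std_normal_distribution ..
  note [measurable] = sup_abs_measurable[OF resampled_measurable resampled_continuous]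
  show ?thesis
  proof (rule P.AE_pair_measure)
    show "{p \<in> space resample_space. 0 < (SUP u\<in>{0..1}. \<bar>resampled u p\<bar>)} \<in> sets resample_space"
      by measurable
    show "AE \<omega> in W. AE z in std_normal_distribution. 0 < (SUP u\<in>{0..1}. \<bar>resampled u (\<omega>, z)\<bar>)"
      using AE_space
    proof eventually_elim
      case (elim \<omega>)
      have "AE z in std_normal_distribution. z \<notin> {0::real}"
        by (rule AE_std_normal_finite) simp
      then show ?case
      proof eventually_elim
        case (elim z)
        have cont: "continuous_on {0..1} (\<lambda>u. resampled u (\<omega>, z))"
          by (rule resampled_continuous) (simp add: space_pair_measure \<open>\<omega> \<in> space W\<close>)
        have "resampled (1/2) (\<omega>, z) \<noteq> 0"
          using elim by (simp add: resampled_def)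
        then have "\<not> (\<forall>u\<in>{0..1}. \<bar>resampled u (\<omega>, z)\<bar> \<le> 0)"
          by (auto intro!: bexI[of _ "1/2"])
        then show ?case
          using sup_abs_le_iff[OF cont, of 0] by linarith
      qed
    qed
  qed
qed

text \<open>Right continuity of the distribution function makes the infimum in
  \<open>quantile\<close> attained. The set is nonempty because \<open>p < 1\<close>, and bounded
  below by 0 because a supremum of absolute values is nonnegative and \<open>p\<close> is
  positive.\<close>

lemma sup_bridge_quantile_coverage:
  assumes p: "0 < p" "p < 1"
  shows "p \<le> prob {\<omega> \<in> space W. (SUP u\<in>{0..1}. \<bar>BB u \<omega>\<bar>) \<le> sup_bridge_quantile W BB p}"
    and "0 \<le> sup_bridge_quantile W BB p"
proof -
  let ?S = "\<lambda>\<omega>. SUP u\<in>{0..1}. \<bar>BB u \<omega>\<bar>"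
  have [measurable]: "?S \<in> borel_measurable W"
    by (rule sup_abs_measurable[OF BB_measurable BB_continuous])
  define M where "M = distr W borel ?S"
  interpret M: real_distribution M
    unfolding M_def by (rule real_distribution_distr) simp
  have cdf: "cdf M x = prob {\<omega> \<in> space W. ?S \<omega> \<le> x}" for x
    unfolding M_def cdf_def by (subst measure_distr) (auto intro!: arg_cong[of _ _ prob])
  let ?A = "{x. p \<le> cdf M x}"
  have q: "sup_bridge_quantile W BB p = Inf ?A"
    by (simp add: sup_bridge_quantile_def quantile_def M_def)
  have "\<forall>\<^sub>F x in at_top. p < cdf M x"
    by (rule order_tendstoD(1)[OF M.cdf_lim_at_top_prob p(2)])
  then have ne: "?A \<noteq> {}"
    using eventually_happens'[of at_top "\<lambda>x. p < cdf M x"] by (auto intro: less_imp_le)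
  have nonneg: "0 \<le> x" if "x \<in> ?A" for x
  proof (rule ccontr)
    assume "\<not> 0 \<le> x"
    have "0 \<le> ?S \<omega>" if "\<omega> \<in> space W" for \<omega>
    proof -
      have "\<bar>BB 0 \<omega>\<bar> \<le> ?S \<omega>"
        using sup_abs_le_iff[OF BB_continuous[OF that], of "?S \<omega>"] by auto
      then show ?thesis by linarith
    qed
    with \<open>\<not> 0 \<le> x\<close> have "{\<omega> \<in> space W. ?S \<omega> \<le> x} = {}" by force
    with cdf[of x] have "cdf M x = 0" by simp
    with that p show False by simp
  qed
  then have bdd: "bdd_below ?A" by (auto intro: bdd_belowI[of _ 0])
  show "0 \<le> sup_bridge_quantile W BB p"
    unfolding q using ne nonneg by (intro cInf_greatest) auto
  have "p \<le> cdf M (Inf ?A)"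
  proof (rule tendsto_lowerbound)
    show "(cdf M \<longlongrightarrow> cdf M (Inf ?A)) (at_right (Inf ?A))"
      using M.cdf_is_right_cont[of "Inf ?A"] by (simp add: continuous_within)
    have "p \<le> cdf M x" if "Inf ?A < x" for x
    proof -
      from cInf_lessD[OF ne that] obtain y where "y \<in> ?A" "y < x"
        by blast
      then show ?thesis using M.cdf_nondecreasing[of y x] by simp
    qed
    then show "\<forall>\<^sub>F x in at_right (Inf ?A). p \<le> cdf M x"
      by (auto simp: eventually_at_right_less eventually_at_filter)
  qed simp
  then show "p \<le> prob {\<omega> \<in> space W. ?S \<omega> \<le> sup_bridge_quantile W BB p}"
    unfolding cdf q .
qed

text \<open>The room between \<open>c\<close> and \<open>q\<close> is what the finite-dimensional
  comparison and the chaining consume later. It costs only \<delta>: as there is no atom at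
  \<open>q\<close>, the events sup \<le> q - 1/(k+1) exhaust an event of probability at least
  \<open>p\<close>.\<close>

lemma resampled_coverage:
  assumes p: "0 < p" "p < 1" and "0 < \<delta>"
  defines "q \<equiv> sup_bridge_quantile W BB p"
  obtains c where "0 \<le> c" "c < q" "\<And>J. finite J \<Longrightarrow> J \<subseteq> {0..1} \<Longrightarrow>
    p - \<delta> \<le> measure resample_space {x \<in> space resample_space. \<forall>t\<in>J. \<bar>resampled t x\<bar> \<le> c}"
proof -
  interpret R: prob_space resample_space by (rule prob_space_resample)
  let ?S = "\<lambda>x. SUP u\<in>{0..1}. \<bar>resampled u x\<bar>"
  have [measurable]: "?S \<in> borel_measurable resample_space"
    by (rule sup_abs_measurable[OF resampled_measurable resampled_continuous])
  have "p \<le> prob {\<omega> \<in> space W. (SUP u\<in>{0..1}. \<bar>BB u \<omega>\<bar>) \<le> q}"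
    unfolding q_def by (rule sup_bridge_quantile_coverage[OF p])
  also have "\<dots> \<le> R.prob {x \<in> space resample_space. ?S x \<le> q}"
    by (rule prob_sup_abs_le_compare[OF prob_space_resample prob_space_axioms resampled_measurable
          BB_measurable resampled_continuous BB_continuous resampled_cf])
       (use sup_bridge_quantile_coverage(2)[OF p] in \<open>auto simp: q_def\<close>)
  finally have le_q: "p \<le> R.prob {x \<in> space resample_space. ?S x \<le> q}" .
  have q: "0 < q"
  proof (rule ccontr)
    assume "\<not> 0 < q"
    with AE_resampled_sup_pos have "AE x in resample_space. \<not> ?S x \<le> q" by auto
    moreover have "{x \<in> space resample_space. ?S x \<le> q} \<in> R.events" by measurable
    ultimately have "R.prob {x \<in> space resample_space. ?S x \<le> q} = 0"
      by (subst R.prob_eq_0) auto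
    with le_q p show False by simp
  qed
  have "R.prob {x \<in> space resample_space. ?S x \<le> q} = R.prob {x \<in> space resample_space. ?S x < q}"
  proof (rule R.finite_measure_eq_AE)
    show "AE x in resample_space. (x \<in> {x \<in> space resample_space. ?S x \<le> q}) =
        (x \<in> {x \<in> space resample_space. ?S x < q})"
      using AE_resampled_sup_neq[OF q] by eventually_elim auto
    show "{x \<in> space resample_space. ?S x \<le> q} \<in> R.events" by measurable
    show "{x \<in> space resample_space. ?S x < q} \<in> R.events" by measurable
  qed
  with le_q have lt_q: "p \<le> R.prob {x \<in> space resample_space. ?S x < q}" by simp
  let ?B = "\<lambda>k. {x \<in> space resample_space. ?S x \<le> q - 1 / real (Suc k)}"
  have "(\<lambda>k. R.prob (?B k)) \<longlonglongrightarrow> R.prob (\<Union>k. ?B k)"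
  proof (rule R.finite_Lim_measure_incseq)
    have "?B k \<in> R.events" for k by measurable
    then show "range ?B \<subseteq> R.events" by blast
    show "incseq ?B"
    proof (rule incseq_SucI)
      fix k
      have "1 / real (Suc (Suc k)) \<le> 1 / real (Suc k)" by (simp add: field_simps)
      then show "?B k \<subseteq> ?B (Suc k)" by force
    qed
  qed
  moreover have "(\<Union>k. ?B k) = {x \<in> space resample_space. ?S x < q}"
  proof (intro set_eqI iffI)
    fix x assume "x \<in> (\<Union>k. ?B k)"
    then obtain k where "x \<in> space resample_space" "?S x \<le> q - 1 / real (Suc k)" by auto
    moreover have "0 < 1 / real (Suc k)" by simp
    ultimately have "?S x < q" by linarith
    with \<open>x \<in> space resample_space\<close> show "x \<in> {x \<in> space resample_space. ?S x < q}" by simp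
  next
    fix x assume x: "x \<in> {x \<in> space resample_space. ?S x < q}"
    then obtain k where "1 / real (Suc k) < q - ?S x"
      using nat_approx_posE[of "q - ?S x"] by auto
    then have "?S x \<le> q - 1 / real (Suc k)" by linarith
    with x show "x \<in> (\<Union>k. ?B k)" by blast
  qed
  ultimately have "(\<lambda>k. R.prob (?B k)) \<longlonglongrightarrow> R.prob {x \<in> space resample_space. ?S x < q}" by simp
  then have "\<forall>\<^sub>F k in sequentially. p - \<delta> < R.prob (?B k)"
    by (rule order_tendstoD) (use lt_q \<open>0 < \<delta>\<close> in linarith)
  \<comment> \<open>Ensures that the level \<open>q - 1 / real (Suc k)\<close> chosen below is
    nonnegative.\<close>
  moreover have "(\<lambda>k. 1 / real (Suc k)) \<longlonglongrightarrow> 0"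
    by (intro LIMSEQ_Suc lim_const_over_n)
  then have "\<forall>\<^sub>F k in sequentially. 1 / real (Suc k) < q"
    by (rule order_tendstoD) (rule q)
  ultimately have "\<forall>\<^sub>F k in sequentially. p - \<delta> < R.prob (?B k) \<and> 1 / real (Suc k) < q"
    by eventually_elim simp
  then obtain k where k: "p - \<delta> < R.prob (?B k)" "1 / real (Suc k) < q"
    using eventually_happens'[OF sequentially_bot] by blast
  show ?thesis
  proof
    show "0 \<le> q - 1 / real (Suc k)" using k by linarith
    show "q - 1 / real (Suc k) < q" by simp
    fix J :: "real set" assume J: "finite J" "J \<subseteq> {0..1}"
    have [measurable]: "t \<in> J \<Longrightarrow> resampled t \<in> borel_measurable resample_space" for t
      using J by (intro resampled_measurable) auto
    have "R.prob (?B k) \<le> R.prob {x \<in> space resample_space. \<forall>t\<in>J. \<bar>resampled t x\<bar> \<le> q - 1 / real (Suc k)}"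
    proof (rule R.finite_measure_mono)
      show "?B k \<subseteq> {x \<in> space resample_space. \<forall>t\<in>J. \<bar>resampled t x\<bar> \<le> q - 1 / real (Suc k)}"
        using J by (auto simp: sup_abs_le_iff[OF resampled_continuous])
      show "{x \<in> space resample_space. \<forall>t\<in>J. \<bar>resampled t x\<bar> \<le> q - 1 / real (Suc k)} \<in> R.events"
        using J(1) by measurable
    qed
    with k show "p - \<delta> \<le> R.prob {x \<in> space resample_space. \<forall>t\<in>J. \<bar>resampled t x\<bar> \<le> q - 1 / real (Suc k)}"
      by linarith
  qed
qed

end

section \<open>The uniform empirical process\<close>

text \<open>Each new point of a grid is one increment of its level away from an old point. At the
  finest level a one-sided Lipschitz bound suffices: from the left neighbour to \<open>u\<close> it
  bounds \<open>a u\<close> from below, and from \<open>u\<close> to the right neighbour it bounds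
  \<open>a u\<close> from above.\<close>

lemma dyadic_chaining:
  fixes a :: "real \<Rightarrow> real"
  assumes lower: "\<And>s t. 0 \<le> s \<Longrightarrow> s \<le> t \<Longrightarrow> t \<le> 1 \<Longrightarrow> a s - K * (t - s) \<le> a t"
    and grid: "\<And>t. t \<in> dyadic_grid m \<Longrightarrow> \<bar>a t\<bar> \<le> A"
    and incr: "\<And>r j. m < r \<Longrightarrow> r \<le> N \<Longrightarrow> j < 2 ^ r \<Longrightarrow>
      \<bar>a (real (Suc j) / 2 ^ r) - a (real j / 2 ^ r)\<bar> \<le> b r"
    and "m \<le> N" "0 \<le> K" "u \<in> {0..1}"
  shows "\<bar>a u\<bar> \<le> A + (\<Sum>r\<in>{m<..N}. b r) + K / 2 ^ N"
proof -
  have grid_le: "n \<le> N \<Longrightarrow> \<forall>t\<in>dyadic_grid n. \<bar>a t\<bar> \<le> A + (\<Sum>r\<in>{m<..n}. b r)" if "m \<le> n" for n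
    using that
  proof (induction n rule: dec_induct)
    case base
    then show ?case using grid by simp
  next
    case (step n)
    show ?case
    proof
      fix t assume "t \<in> dyadic_grid (Suc n)"
      then obtain j where j: "j \<le> 2 ^ Suc n" "t = real j / 2 ^ Suc n" by (auto simp: dyadic_grid_def)
      have sum: "(\<Sum>r\<in>{m<..Suc n}. b r) = (\<Sum>r\<in>{m<..n}. b r) + b (Suc n)"
      proof -
        have "{m<..Suc n} = insert (Suc n) {m<..n}" using step by auto
        then show ?thesis by simp
      qed
      have b: "0 \<le> b (Suc n)"
        using incr[of "Suc n" 0] step by auto
      have IH: "\<bar>a (real i / 2 ^ n)\<bar> \<le> A + (\<Sum>r\<in>{m<..n}. b r)" if "i \<le> 2 ^ n" for i
        using step that by (auto simp: dyadic_grid_def)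
      consider i where "j = 2 * i" | i where "j = Suc (2 * i)"
        by (metis evenE oddE add.right_neutral add_Suc_right One_nat_def)
      then show "\<bar>a t\<bar> \<le> A + (\<Sum>r\<in>{m<..Suc n}. b r)"
      proof cases
        case 1
        with j IH[of i] b show ?thesis by (simp add: sum)
      next
        case 2
        then have i: "i \<le> 2 ^ n" "2 * i < 2 ^ Suc n" using j by auto
        have "\<bar>a t - a (real i / 2 ^ n)\<bar> \<le> b (Suc n)"
          using incr[of "Suc n" "2 * i"] i step 2 j by simp
        with IH[OF i(1)] show ?thesis by (simp add: sum)
      qed
    qed
  qed
  let ?B = "A + (\<Sum>r\<in>{m<..N}. b r)"
  have G: "\<bar>a (real j / 2 ^ N)\<bar> \<le> ?B" if "j \<le> 2 ^ N" for j
    using grid_le[OF \<open>m \<le> N\<close>] that by (auto simp: dyadic_grid_def)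
  obtain j where j: "j \<le> 2 ^ N" "real j / 2 ^ N \<le> u" "u < real (Suc j) / 2 ^ N"
    using dyadic_floor[OF \<open>u \<in> {0..1}\<close>] by metis
  show ?thesis
  proof (cases "j = 2 ^ N")
    \<comment> \<open>Only u = 1 lands here, where there is no right neighbour in the unit
      interval.\<close>
    case True
    with j \<open>u \<in> {0..1}\<close> have "u = real j / 2 ^ N" by simp
    with G[OF j(1)] have "\<bar>a u\<bar> \<le> ?B" by simp
    then show ?thesis using \<open>0 \<le> K\<close> by (auto intro: add_increasing2)
  next
    case False
    then have Suc: "Suc j \<le> 2 ^ N" using j by simp
    then have "real (Suc j) \<le> 2 ^ N" by (simp only: flip: of_nat_le_iff[where 'a=real]) simp
    then have le1: "real (Suc j) / 2 ^ N \<le> 1" by simp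
    have gap: "real (Suc j) / 2 ^ N = real j / 2 ^ N + 1 / 2 ^ N" by (simp add: add_divide_distrib)
    have K1: "K * (u - real j / 2 ^ N) \<le> K / 2 ^ N" "K * (real (Suc j) / 2 ^ N - u) \<le> K / 2 ^ N"
      using mult_left_mono[OF _ \<open>0 \<le> K\<close>, of "u - real j / 2 ^ N" "1 / 2 ^ N"]
        mult_left_mono[OF _ \<open>0 \<le> K\<close>, of "real (Suc j) / 2 ^ N - u" "1 / 2 ^ N"] j gap
      by auto
    have "a (real j / 2 ^ N) - K * (u - real j / 2 ^ N) \<le> a u"
      using j \<open>u \<in> {0..1}\<close> by (intro lower) auto
    moreover have "a u - K * (real (Suc j) / 2 ^ N - u) \<le> a (real (Suc j) / 2 ^ N)"
      using j le1 \<open>u \<in> {0..1}\<close> by (intro lower) auto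
    ultimately show ?thesis
      using K1 G[OF j(1)] G[OF Suc] by linarith
  qed
qed

text \<open>Uniformity in \<open>N\<close> matters because the depth of the chain grows with the
  sample size while its starting level stays fixed.\<close>

lemma geometric_tail_le:
  fixes x :: real
  assumes "0 \<le> x" "x < 1" "0 < e"
  shows "\<forall>\<^sub>F m in sequentially. \<forall>N. (\<Sum>r\<in>{m<..N}. x ^ r) \<le> e"
proof -
  have "summable (\<lambda>r. x ^ r)"
    using assms by (intro summable_geometric) auto
  then obtain k where k: "\<And>m n. k \<le> m \<Longrightarrow> norm (\<Sum>r\<in>{m..<n}. x ^ r) < e"
    using \<open>0 < e\<close> unfolding summable_Cauchy by blast
  have "(\<Sum>r\<in>{m<..N}. x ^ r) \<le> e" if "k \<le> m" for m N
  proof -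
    have "{m<..N} = {Suc m..<Suc N}" by auto
    with k[of "Suc m" "Suc N"] that show ?thesis by auto
  qed
  then show ?thesis unfolding eventually_sequentially by blast
qed

text \<open>Induction splits off the last summand, which is independent of the partial sum. Cross
  terms containing a first power of either vanish, X^4 \<le> X^2 supplies the linear term, and the
  remaining 6 n v^2 fits into the increase 3 (2 n + 1) v^2 of the quadratic term; this is the origin
  of the factor 3.\<close>

lemma (in prob_space) sum_centered_moments:
  fixes X :: "nat \<Rightarrow> 'a \<Rightarrow> real"
  assumes indep: "indep_vars (\<lambda>_. borel) X UNIV"
    and bound: "\<And>i \<omega>. \<bar>X i \<omega>\<bar> \<le> 1"
    and mean: "\<And>i. expectation (X i) = 0"
    and var: "\<And>i. expectation (\<lambda>\<omega>. (X i \<omega>)\<^sup>2) = v"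
  shows "expectation (\<lambda>\<omega>. (\<Sum>i<n. X i \<omega>)\<^sup>2) = real n * v"
    and "expectation (\<lambda>\<omega>. (\<Sum>i<n. X i \<omega>) ^ 4) \<le> real n * v + 3 * (real n * v)\<^sup>2"
proof -
  have X [measurable]: "X i \<in> borel_measurable M" for i
    using indep unfolding indep_vars_def2 by simp
  define S where "S n \<omega> = (\<Sum>i<n. X i \<omega>)" for n \<omega>
  have S [measurable]: "S n \<in> borel_measurable M" for n unfolding S_def by measurable
  have Sb: "\<bar>S n \<omega>\<bar> \<le> real n" for n \<omega>
    unfolding S_def using sum_norm_le[of "{..<n}" "\<lambda>i. X i \<omega>" "\<lambda>_. 1"] bound by simp
  have int: "integrable M (\<lambda>\<omega>. S n \<omega> ^ k)" "integrable M (\<lambda>\<omega>. X n \<omega> ^ k)" for n k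
  proof -
    show "integrable M (\<lambda>\<omega>. S n \<omega> ^ k)"
      using Sb by (intro integrable_const_bound[where B = "real n ^ k"])
        (auto simp: power_abs intro!: power_mono)
    show "integrable M (\<lambda>\<omega>. X n \<omega> ^ k)"
      using bound by (intro integrable_const_bound[where B = 1]) (auto simp: power_abs intro!: power_le_one)
  qed
  have prod: "integrable M (\<lambda>\<omega>. X n \<omega> ^ k * S n \<omega> ^ l)"
     "expectation (\<lambda>\<omega>. X n \<omega> ^ k * S n \<omega> ^ l) = expectation (\<lambda>\<omega>. X n \<omega> ^ k) * expectation (\<lambda>\<omega>. S n \<omega> ^ l)"
    for n k l
  proof -
    have "indep_var borel (X n) borel (\<lambda>\<omega>. \<Sum>i<n. X i \<omega>)"
      by (intro indep_vars_sum indep_vars_subset[OF indep]) auto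
    then have "indep_var borel ((\<lambda>x. x ^ k) \<circ> X n) borel ((\<lambda>x. x ^ l) \<circ> S n)"
      unfolding S_def[abs_def] by (rule indep_var_compose) auto
    then have ind: "indep_var borel (\<lambda>\<omega>. X n \<omega> ^ k) borel (\<lambda>\<omega>. S n \<omega> ^ l)"
      by (simp add: comp_def)
    show "integrable M (\<lambda>\<omega>. X n \<omega> ^ k * S n \<omega> ^ l)"
      by (rule indep_var_integrable[OF ind int(2) int(1)])
    show "expectation (\<lambda>\<omega>. X n \<omega> ^ k * S n \<omega> ^ l) = expectation (\<lambda>\<omega>. X n \<omega> ^ k) * expectation (\<lambda>\<omega>. S n \<omega> ^ l)"
      by (rule indep_var_lebesgue_integral[OF ind int(2) int(1)])
  qed
  have v0: "0 \<le> v" unfolding var[of 0, symmetric] by simp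
  have X4: "expectation (\<lambda>\<omega>. X i \<omega> ^ 4) \<le> v" for i
  proof -
    have "expectation (\<lambda>\<omega>. X i \<omega> ^ 4) \<le> expectation (\<lambda>\<omega>. (X i \<omega>)\<^sup>2)"
    proof (intro integral_mono int)
      fix \<omega>
      have "(X i \<omega>)\<^sup>2 \<le> 1" using bound[of i \<omega>] by (simp add: abs_square_le_1)
      then have "(X i \<omega>)\<^sup>2 * (X i \<omega>)\<^sup>2 \<le> (X i \<omega>)\<^sup>2 * 1" by (intro mult_left_mono) auto
      then show "X i \<omega> ^ 4 \<le> (X i \<omega>)\<^sup>2" by (simp flip: power_add)
    qed
    then show ?thesis using var by simp
  qed
  have S1: "expectation (S n) = 0" for n
    unfolding S_def[abs_def] using int(2)[of _ 1] mean by simp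
  have S2: "expectation (\<lambda>\<omega>. S n \<omega> ^ 2) = real n * v" for n
  proof (induction n)
    case (Suc n)
    have "(\<lambda>\<omega>. S (Suc n) \<omega> ^ 2) = (\<lambda>\<omega>. S n \<omega> ^ 2 + 2 * (X n \<omega> ^ 1 * S n \<omega> ^ 1) + X n \<omega> ^ 2)"
      by (simp add: S_def power2_eq_square algebra_simps)
    then have "expectation (\<lambda>\<omega>. S (Suc n) \<omega> ^ 2) =
        expectation (\<lambda>\<omega>. S n \<omega> ^ 2 + 2 * (X n \<omega> ^ 1 * S n \<omega> ^ 1) + X n \<omega> ^ 2)" by simp
    also have "\<dots> = expectation (\<lambda>\<omega>. S n \<omega> ^ 2) + 2 * expectation (\<lambda>\<omega>. X n \<omega> ^ 1 * S n \<omega> ^ 1) + expectation (\<lambda>\<omega>. X n \<omega> ^ 2)"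
      using int prod(1)[of n 1 1] by simp
    also have "\<dots> = real n * v + 0 + v"
      unfolding prod(2) Suc.IH var using mean by simp
    finally show ?case by (simp add: algebra_simps)
  qed (simp add: S_def)
  then show "expectation (\<lambda>\<omega>. (\<Sum>i<n. X i \<omega>)\<^sup>2) = real n * v" for n unfolding S_def .
  have "expectation (\<lambda>\<omega>. S n \<omega> ^ 4) \<le> real n * v + 3 * (real n * v)\<^sup>2" for n
  proof (induction n)
    case (Suc n)
    let ?P = "\<lambda>k l \<omega>. X n \<omega> ^ k * S n \<omega> ^ l"
    have "S (Suc n) \<omega> ^ 4 =
        S n \<omega> ^ 4 + 4 * ?P 1 3 \<omega> + 6 * ?P 2 2 \<omega> + 4 * ?P 3 1 \<omega> + X n \<omega> ^ 4" for \<omega>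
    proof -
      have "(s + x) ^ 4 = s ^ 4 + 4 * (x ^ 1 * s ^ 3) + 6 * (x ^ 2 * s ^ 2) + 4 * (x ^ 3 * s ^ 1) + x ^ 4"
        for s x :: real
        by (simp add: power4_eq_xxxx power3_eq_cube power2_eq_square algebra_simps)
      then show ?thesis by (simp add: S_def)
    qed
    then have "expectation (\<lambda>\<omega>. S (Suc n) \<omega> ^ 4) = expectation (\<lambda>\<omega>.
        S n \<omega> ^ 4 + 4 * ?P 1 3 \<omega> + 6 * ?P 2 2 \<omega> + 4 * ?P 3 1 \<omega> + X n \<omega> ^ 4)"
      by simp
    also have "\<dots> = expectation (\<lambda>\<omega>. S n \<omega> ^ 4) + 4 * expectation (?P 1 3) + 6 * expectation (?P 2 2)
        + 4 * expectation (?P 3 1) + expectation (\<lambda>\<omega>. X n \<omega> ^ 4)"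
      using int prod(1)[of n 1 3] prod(1)[of n 2 2] prod(1)[of n 3 1] by simp
    also have "expectation (?P 1 3) = 0" unfolding prod(2) using mean by simp
    also have "expectation (?P 3 1) = 0" unfolding prod(2) using S1 by simp
    also have "expectation (?P 2 2) = v * (real n * v)" unfolding prod(2) S2 using var by simp
    also have "expectation (\<lambda>\<omega>. S n \<omega> ^ 4) + 4 * 0 + 6 * (v * (real n * v)) + 4 * 0
          + expectation (\<lambda>\<omega>. X n \<omega> ^ 4)
        \<le> real n * v + 3 * (real n * v)\<^sup>2 + 6 * (v * (real n * v)) + v"
      using Suc.IH X4[of n] by simp
    also have "\<dots> \<le> real (Suc n) * v + 3 * (real (Suc n) * v)\<^sup>2"
      using v0 by (simp add: power2_eq_square algebra_simps)
    finally show ?case .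
  qed (simp add: S_def)
  then show "expectation (\<lambda>\<omega>. (\<Sum>i<n. X i \<omega>) ^ 4) \<le> real n * v + 3 * (real n * v)\<^sup>2"
    unfolding S_def .
qed

text \<open>Uniformity is expressed by the distribution function on [0,1], the form in which the
  probability integral transform delivers it.\<close>

locale iid_uniform = prob_space M for M :: "'a measure" +
  fixes U :: "nat \<Rightarrow> 'a \<Rightarrow> real" and \<mu> :: "real measure"
  assumes indep: "indep_vars (\<lambda>_. borel) U UNIV"
    and distr_U: "\<And>i. distr M borel (U i) = \<mu>"
    and uniform: "\<And>u. u \<in> {0..1} \<Longrightarrow> measure \<mu> {..u} = u"
begin

lemma U_measurable [measurable]: "U i \<in> borel_measurable M"
  using indep unfolding indep_vars_def2 by simp

definition centered :: "real \<Rightarrow> nat \<Rightarrow> 'a \<Rightarrow> real" where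
  "centered t i \<omega> = indicator {..t} (U i \<omega>) - t"

definition emp_process :: "nat \<Rightarrow> real \<Rightarrow> 'a \<Rightarrow> real" where
  "emp_process n t \<omega> = (\<Sum>i<n. centered t i \<omega>) / sqrt (real n)"

lemma centered_measurable [measurable]: "centered t i \<in> borel_measurable M"
  unfolding centered_def[abs_def] by measurable

lemma emp_process_measurable [measurable]: "emp_process n t \<in> borel_measurable M"
  unfolding emp_process_def[abs_def] by measurable

lemma expectation_indicator_U:
  assumes "t \<in> {0..1}"
  shows "expectation (\<lambda>\<omega>. indicator {..t} (U i \<omega>)) = t"
proof -
  have "expectation (\<lambda>\<omega>. indicator {..t} (U i \<omega>)) = (\<integral>x. indicator {..t} x \<partial>distr M borel (U i) :: real)"
    by (rule integral_distr[symmetric]) auto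
  also have "\<dots> = measure \<mu> {..t}"
    unfolding distr_U[symmetric, of i] by simp
  finally show ?thesis using uniform[OF assms] by simp
qed

lemma abs_centered_le: "t \<in> {0..1} \<Longrightarrow> \<bar>centered t i \<omega>\<bar> \<le> 1"
  by (auto simp: centered_def indicator_def)

lemma integrable_indicator_U: "integrable M (\<lambda>\<omega>. indicator {..t} (U i \<omega>) :: real)"
  by (intro integrable_const_bound[where B = 1]) auto

lemma expectation_centered: "t \<in> {0..1} \<Longrightarrow> expectation (centered t i) = 0"
  unfolding centered_def[abs_def]
  by (simp add: integrable_indicator_U expectation_indicator_U prob_space)

lemma integrable_centered: "integrable M (centered t i)"
  unfolding centered_def[abs_def] by (intro Bochner_Integration.integrable_diff integrable_indicator_U) auto

lemma covariance_centered:
  assumes "s \<in> {0..1}" "t \<in> {0..1}"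
  shows "integrable M (\<lambda>\<omega>. centered s i \<omega> * centered t i \<omega>)"
    and "expectation (\<lambda>\<omega>. centered s i \<omega> * centered t i \<omega>) = min s t - s * t"
proof -
  have eq: "(\<lambda>\<omega>. centered s i \<omega> * centered t i \<omega>) =
    (\<lambda>\<omega>. indicator {..min s t} (U i \<omega>) - s * indicator {..t} (U i \<omega>) - t * indicator {..s} (U i \<omega>) + s * t)"
    by (rule ext) (auto simp: centered_def indicator_def algebra_simps)
  show "integrable M (\<lambda>\<omega>. centered s i \<omega> * centered t i \<omega>)"
    unfolding eq using integrable_indicator_U
    by (intro Bochner_Integration.integrable_diff Bochner_Integration.integrable_add
        integrable_mult_right) auto
  have m: "min s t \<in> {0..1}" using assms by auto
  have "expectation (\<lambda>\<omega>. centered s i \<omega> * centered t i \<omega>) = min s t - s * t - t * s + s * t"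
    unfolding eq using integrable_indicator_U expectation_indicator_U[OF m]
      expectation_indicator_U[OF assms(1)] expectation_indicator_U[OF assms(2)]
    by (simp add: prob_space)
  then show "expectation (\<lambda>\<omega>. centered s i \<omega> * centered t i \<omega>) = min s t - s * t" by simp
qed

text \<open>The Cramer-Wold device: for fixed coefficients the combination over times is itself a
  normalised sum of i.i.d. centred variables, and its variance is the bridge's.\<close>

lemma emp_process_cf_tendsto:
  assumes S: "finite S" "S \<subseteq> {0..1}"
  shows "(\<lambda>n. expectation (\<lambda>\<omega>. iexp (\<Sum>t\<in>S. c t * emp_process n t \<omega>)))
    \<longlonglongrightarrow> of_real (exp (- bridge_form S c / 2))"
proof -
  have in01: "t \<in> S \<Longrightarrow> t \<in> {0..1}" for t using S by auto
  define g where "g x = (\<Sum>t\<in>S. c t * (indicator {..t} x - t))" for x :: real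
  have [measurable]: "g \<in> borel_measurable borel" unfolding g_def[abs_def] by measurable
  define X where "X i \<omega> = g (U i \<omega>)" for i \<omega>
  have X_eq: "X i \<omega> = (\<Sum>t\<in>S. c t * centered t i \<omega>)" for i \<omega>
    by (simp add: X_def g_def centered_def)
  have [measurable]: "X i \<in> borel_measurable M" for i unfolding X_def[abs_def] by measurable
  have indepX: "indep_vars (\<lambda>_. borel) X UNIV"
    unfolding X_def[abs_def] by (rule indep_vars_compose2[OF indep]) simp
  have distrX: "distr M borel (X i) = distr \<mu> borel g" for i
    unfolding distr_U[of i, symmetric] by (subst distr_distr) (auto simp: comp_def X_def[abs_def])
  have meanX: "expectation (X i) = 0" for i
    unfolding X_eq[abs_def] using integrable_centered expectation_centered[OF in01] by simp
  have int2: "integrable M (\<lambda>\<omega>. (X i \<omega>)\<^sup>2)"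
    and var: "expectation (\<lambda>\<omega>. (X i \<omega>)\<^sup>2) = bridge_form S c" for i
  proof -
    have int: "integrable M (\<lambda>\<omega>. c s * c t * (centered s i \<omega> * centered t i \<omega>))" if "s \<in> S" "t \<in> S" for s t
      by (intro integrable_mult_right covariance_centered in01 that)
    show "integrable M (\<lambda>\<omega>. (X i \<omega>)\<^sup>2)"
      unfolding X_eq sum_mult_eq_double_sum using int by (intro Bochner_Integration.integrable_sum)
    have "expectation (\<lambda>\<omega>. (X i \<omega>)\<^sup>2) =
        (\<Sum>s\<in>S. \<Sum>t\<in>S. expectation (\<lambda>\<omega>. c s * c t * (centered s i \<omega> * centered t i \<omega>)))"
      unfolding X_eq sum_mult_eq_double_sum using int
      by (simp add: Bochner_Integration.integral_sum Bochner_Integration.integrable_sum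
          del: integral_mult_right_zero integrable_mult_right_iff cong: sum.cong)
    also have "\<dots> = bridge_form S c"
      unfolding bridge_form_def using covariance_centered(2)[OF in01 in01]
      by (intro sum.cong refl) simp
    finally show "expectation (\<lambda>\<omega>. (X i \<omega>)\<^sup>2) = bridge_form S c" .
  qed
  have sum_eq: "(\<Sum>t\<in>S. c t * emp_process n t \<omega>) = (\<Sum>i<n. X i \<omega>) / sqrt (real n)" for n \<omega>
  proof -
    have "(\<Sum>t\<in>S. c t * emp_process n t \<omega>) = (\<Sum>t\<in>S. \<Sum>i<n. c t * centered t i \<omega>) / sqrt (real n)"
      by (simp add: emp_process_def sum_divide_distrib sum_distrib_left)
    also have "(\<Sum>t\<in>S. \<Sum>i<n. c t * centered t i \<omega>) = (\<Sum>i<n. X i \<omega>)"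
      unfolding X_eq by (rule sum.swap)
    finally show ?thesis .
  qed
  have "0 \<le> bridge_form S c" unfolding var[of 0, symmetric] by simp
  \<comment> \<open>The central limit theorem requires positive variance, which fails for instance
    when \<open>S\<close> is contained in {0, 1}; the summands then vanish almost surely.\<close>
  then consider "bridge_form S c = 0" | "0 < bridge_form S c" by linarith
  then show ?thesis
  proof cases
    case 1
    have "AE \<omega> in M. X i \<omega> = 0" for i
    proof -
      have "AE \<omega> in M. (X i \<omega>)\<^sup>2 = 0"
        using var[of i] int2[of i] 1 by (subst integral_nonneg_eq_0_iff_AE[symmetric]) auto
      then show ?thesis by simp
    qed
    then have "AE \<omega> in M. \<forall>i. X i \<omega> = 0" by (simp add: AE_all_countable)
    then have "expectation (\<lambda>\<omega>. iexp (\<Sum>t\<in>S. c t * emp_process n t \<omega>)) = expectation (\<lambda>\<omega>. 1)" for n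
      unfolding sum_eq by (intro integral_cong_AE) (auto elim!: eventually_mono)
    then show ?thesis by (simp add: 1 prob_space)
  next
    case 2
    \<comment> \<open>The limit theorem divides by \<sigma>; reading the characteristic functions at
      frequency \<sigma> undoes this.\<close>
    define \<sigma> where "\<sigma> = sqrt (bridge_form S c)"
    have \<sigma>: "0 < \<sigma>" "\<sigma>\<^sup>2 = bridge_form S c" using 2 by (auto simp: \<sigma>_def)
    have "weak_conv_m (\<lambda>n. distr M borel (\<lambda>x. (\<Sum>i<n. X i x) / sqrt (real n * \<sigma>\<^sup>2))) std_normal_distribution"
      using \<sigma> int2 var meanX distrX
      by (intro central_limit_theorem_zero_mean[OF indepX]) auto
    then have "(\<lambda>n. char (distr M borel (\<lambda>x. (\<Sum>i<n. X i x) / sqrt (real n * \<sigma>\<^sup>2))) \<sigma>)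
        \<longlonglongrightarrow> char std_normal_distribution \<sigma>"
      by (intro levy_continuity1 real_dist_normal_dist real_distribution_distr) auto
    moreover have "char (distr M borel (\<lambda>x. (\<Sum>i<n. X i x) / sqrt (real n * \<sigma>\<^sup>2))) \<sigma> =
        expectation (\<lambda>\<omega>. iexp (\<Sum>t\<in>S. c t * emp_process n t \<omega>))" for n
    proof -
      have "\<sigma> * (y / sqrt (real n * \<sigma>\<^sup>2)) = y / sqrt (real n)" for y
        using \<sigma>(1) by (simp add: real_sqrt_mult)
      then show ?thesis
        unfolding char_def sum_eq by (subst integral_distr) auto
    qed
    ultimately show ?thesis by (simp add: char_std_normal_distribution \<sigma>)
  qed
qed

lemma emp_process_tight:
  assumes "0 < e"
  shows "\<exists>L. \<forall>n. \<forall>t\<in>{0..1}. prob {\<omega> \<in> space M. L < \<bar>emp_process n t \<omega>\<bar>} \<le> e"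
proof -
  \<comment> \<open>Chosen for Chebyshev's inequality: the variance is at most 1 for all
    \<open>n\<close> and \<open>t\<close>, so the tail beyond \<open>L\<close> has probability at
    most 1 / L^2.\<close>
  define L where "L = 1 / sqrt e"
  have L: "0 < L" "L\<^sup>2 = 1 / e" using assms by (auto simp: L_def power_divide)
  have "prob {\<omega> \<in> space M. L < \<bar>emp_process n t \<omega>\<bar>} \<le> e" if t: "t \<in> {0..1}" for n t
  proof -
    have indc: "indep_vars (\<lambda>_. borel) (centered t) UNIV"
      unfolding centered_def[abs_def] by (rule indep_vars_compose2[OF indep]) simp
    have "expectation (\<lambda>\<omega>. (\<Sum>i<n. centered t i \<omega>)\<^sup>2) = real n * (t - t * t)"
      using t covariance_centered(2)[OF t t]
      by (intro sum_centered_moments(1)[OF indc] abs_centered_le expectation_centered)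
        (auto simp: power2_eq_square)
    then have E: "expectation (\<lambda>\<omega>. (emp_process n t \<omega>)\<^sup>2) = real n * (t - t * t) / real n"
      unfolding emp_process_def by (simp add: power_divide)
    also have "\<dots> \<le> 1"
    proof -
      have "0 \<le> t * t" by simp
      with t have "t - t * t \<le> 1" unfolding atLeastAtMost_iff by linarith
      then show ?thesis by (cases "n = 0") auto
    qed
    finally have E1: "expectation (\<lambda>\<omega>. (emp_process n t \<omega>)\<^sup>2) \<le> 1" .
    have int: "integrable M (\<lambda>\<omega>. (emp_process n t \<omega>)\<^sup>2)"
    proof (rule integrable_const_bound[where B = "(real n / sqrt (real n))\<^sup>2"])
      have "\<bar>\<Sum>i<n. centered t i \<omega>\<bar> \<le> real n" for \<omega>
        using sum_norm_le[of "{..<n}" "\<lambda>i. centered t i \<omega>" "\<lambda>_. 1"] abs_centered_le[OF t] by simp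
      then have "\<bar>emp_process n t \<omega>\<bar> \<le> \<bar>real n / sqrt (real n)\<bar>" for \<omega>
        by (simp add: emp_process_def abs_divide divide_right_mono)
      then show "AE \<omega> in M. norm ((emp_process n t \<omega>)\<^sup>2) \<le> (real n / sqrt (real n))\<^sup>2"
        by (simp only: real_norm_def abs_power2 abs_le_square_iff) simp
    qed simp
    have "prob {\<omega> \<in> space M. L < \<bar>emp_process n t \<omega>\<bar>} \<le> prob {\<omega> \<in> space M. L\<^sup>2 \<le> (emp_process n t \<omega>)\<^sup>2}"
    proof (intro finite_measure_mono)
      show "{\<omega> \<in> space M. L < \<bar>emp_process n t \<omega>\<bar>} \<subseteq> {\<omega> \<in> space M. L\<^sup>2 \<le> (emp_process n t \<omega>)\<^sup>2}"
        using L(1) by (auto simp flip: abs_le_square_iff)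
    qed simp
    also have "\<dots> \<le> expectation (\<lambda>\<omega>. (emp_process n t \<omega>)\<^sup>2) / L\<^sup>2"
      using L(1) by (intro integral_Markov_inequality_measure[where A = "space M"] int) auto
    also have "\<dots> \<le> 1 / L\<^sup>2" using E1 by (intro divide_right_mono) auto
    also have "\<dots> = e" using L assms by simp
    finally show ?thesis .
  qed
  then show ?thesis by blast
qed

text \<open>The hypothesis \<open>1 \<le> real n * (t - s)\<close> absorbs the linear term of the
  fourth moment into the quadratic one, whence 4 = 1 + 3. A bound quadratic in the length is what a
  union over the 2^r increments of a dyadic level can afford.\<close>

lemma emp_process_increment_prob:
  assumes st: "0 \<le> s" "s \<le> t" "t \<le> 1" and n: "1 \<le> real n * (t - s)" and "0 < b"
  shows "prob {\<omega> \<in> space M. b < \<bar>emp_process n t \<omega> - emp_process n s \<omega>\<bar>} \<le> 4 * (t - s)\<^sup>2 / b ^ 4"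
proof -
  have s: "s \<in> {0..1}" and t: "t \<in> {0..1}" using st by auto
  define X where "X i \<omega> = centered t i \<omega> - centered s i \<omega>" for i \<omega>
  have [measurable]: "X i \<in> borel_measurable M" for i unfolding X_def[abs_def] by measurable
  have indX: "indep_vars (\<lambda>_. borel) X UNIV"
    unfolding X_def[abs_def] centered_def by (rule indep_vars_compose2[OF indep]) simp
  have bound: "\<bar>X i \<omega>\<bar> \<le> 1" for i \<omega>
    using st by (auto simp: X_def centered_def indicator_def)
  have mean: "expectation (X i) = 0" for i
    unfolding X_def[abs_def] using expectation_centered[OF s] expectation_centered[OF t] integrable_centered
    by simp
  define v where "v = (t - s) - (t - s)\<^sup>2"
  have var: "expectation (\<lambda>\<omega>. (X i \<omega>)\<^sup>2) = v" for i
  proof -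
    have "expectation (\<lambda>\<omega>. (X i \<omega>)\<^sup>2) = expectation (\<lambda>\<omega>. centered t i \<omega> * centered t i \<omega>
        - 2 * (centered s i \<omega> * centered t i \<omega>) + centered s i \<omega> * centered s i \<omega>)"
      by (simp add: X_def power2_eq_square algebra_simps)
    also have "\<dots> = (t - t * t) - 2 * (s - s * t) + (s - s * s)"
      using covariance_centered[OF s t, of i] covariance_centered[OF s s, of i]
        covariance_centered[OF t t, of i] st by simp
    finally show ?thesis by (simp add: v_def power2_eq_square algebra_simps)
  qed
  let ?p = "t - s"
  have v: "0 \<le> v" "v \<le> ?p"
    unfolding var[of 0, symmetric] by (simp, simp add: var v_def)
  have n0: "0 < real n" using n by (cases "n = 0") auto
  have p0: "0 \<le> ?p" using st by simp
  define Z where "Z \<omega> = emp_process n t \<omega> - emp_process n s \<omega>" for \<omega>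
  have [measurable]: "Z \<in> borel_measurable M" unfolding Z_def[abs_def] by measurable
  have Z: "Z \<omega> = (\<Sum>i<n. X i \<omega>) / sqrt (real n)" for \<omega>
    by (simp add: Z_def emp_process_def X_def sum_subtractf diff_divide_distrib)
  have sq4: "sqrt (real n) ^ 4 = (real n)\<^sup>2"
    using power_mult[of "sqrt (real n)" 2 2] by simp
  have Sb: "\<bar>\<Sum>i<n. X i \<omega>\<bar> \<le> real n" for \<omega>
    using sum_norm_le[of "{..<n}" "\<lambda>i. X i \<omega>" "\<lambda>_. 1"] bound by simp
  have int: "integrable M (\<lambda>\<omega>. Z \<omega> ^ 4)"
  proof (rule integrable_const_bound[where B = "real n ^ 4 / (real n)\<^sup>2"])
    have "\<bar>\<Sum>i<n. X i \<omega>\<bar> ^ 4 / (real n)\<^sup>2 \<le> real n ^ 4 / (real n)\<^sup>2" for \<omega>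
      by (intro divide_right_mono power_mono Sb) auto
    then show "AE \<omega> in M. norm (Z \<omega> ^ 4) \<le> real n ^ 4 / (real n)\<^sup>2"
      by (simp add: Z power_divide sq4 power_abs)
  qed simp
  have "expectation (\<lambda>\<omega>. Z \<omega> ^ 4) = expectation (\<lambda>\<omega>. (\<Sum>i<n. X i \<omega>) ^ 4) / (real n)\<^sup>2"
    unfolding Z power_divide sq4 by simp
  also have "\<dots> \<le> (real n * v + 3 * (real n * v)\<^sup>2) / (real n)\<^sup>2"
    by (intro divide_right_mono sum_centered_moments(2)[OF indX bound mean var]) auto
  also have "\<dots> \<le> ((real n * ?p) * (real n * ?p) + 3 * (real n * ?p)\<^sup>2) / (real n)\<^sup>2"
  proof (intro divide_right_mono add_mono mult_left_mono power_mono)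
    have "real n * v \<le> 1 * (real n * ?p)" using v n0 by simp
    also have "\<dots> \<le> (real n * ?p) * (real n * ?p)" using n by (intro mult_right_mono) auto
    finally show "real n * v \<le> (real n * ?p) * (real n * ?p)" .
  qed (use v n0 in auto)
  also have "\<dots> = 4 * ?p\<^sup>2" using n0 by (simp add: power2_eq_square field_simps)
  finally have E: "expectation (\<lambda>\<omega>. Z \<omega> ^ 4) \<le> 4 * ?p\<^sup>2" .
  have "prob {\<omega> \<in> space M. b < \<bar>Z \<omega>\<bar>} \<le> prob {\<omega> \<in> space M. b ^ 4 \<le> Z \<omega> ^ 4}"
  proof (intro finite_measure_mono subsetI)
    fix \<omega> assume *: "\<omega> \<in> {\<omega> \<in> space M. b < \<bar>Z \<omega>\<bar>}"
    then have "b ^ 4 \<le> \<bar>Z \<omega>\<bar> ^ 4" using \<open>0 < b\<close> by (intro power_mono) auto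
    then show "\<omega> \<in> {\<omega> \<in> space M. b ^ 4 \<le> Z \<omega> ^ 4}" using * by simp
  qed simp
  also have "\<dots> \<le> expectation (\<lambda>\<omega>. Z \<omega> ^ 4) / b ^ 4"
    using \<open>0 < b\<close> by (intro integral_Markov_inequality_measure[where A = "space M"] int) auto
  also have "\<dots> \<le> 4 * ?p\<^sup>2 / b ^ 4"
    using E \<open>0 < b\<close> by (intro divide_right_mono) auto
  finally show ?thesis unfolding Z_def .
qed

text \<open>Counts only grow with time, so the process can fall only through its centring, at rate
  sqrt n.\<close>

lemma emp_process_lower:
  assumes "s \<le> t"
  shows "emp_process n s \<omega> - sqrt (real n) * (t - s) \<le> emp_process n t \<omega>"
proof (cases "n = 0")
  case False
  have "(\<Sum>i<n. centered s i \<omega>) - (\<Sum>i<n. t - s) \<le> (\<Sum>i<n. centered t i \<omega>)"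
    unfolding sum_subtractf[symmetric] centered_def
    using assms by (intro sum_mono) (auto simp: indicator_def)
  then have "((\<Sum>i<n. centered s i \<omega>) - real n * (t - s)) / sqrt (real n) \<le> emp_process n t \<omega>"
    unfolding emp_process_def by (intro divide_right_mono) auto
  moreover have "real n * (t - s) / sqrt (real n) = sqrt (real n) * (t - s)"
    by (simp add: real_div_sqrt flip: times_divide_eq_left)
  ultimately show ?thesis by (simp add: diff_divide_distrib emp_process_def)
qed (simp add: emp_process_def)

definition oscillation_event :: "nat \<Rightarrow> nat \<Rightarrow> nat \<Rightarrow> real \<Rightarrow> 'a set" where
  "oscillation_event n m N \<rho> = (\<Union>r\<in>{m<..N}. \<Union>j\<in>{..<2 ^ r}. {\<omega> \<in> space M.
     \<rho> ^ r < \<bar>emp_process n (real (Suc j) / 2 ^ r) \<omega> - emp_process n (real j / 2 ^ r) \<omega>\<bar>})"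

lemma oscillation_event_measurable [measurable]: "oscillation_event n m N \<rho> \<in> events"
  unfolding oscillation_event_def by measurable

text \<open>Level r contributes 2^r increments of length 2^(-r), each exceeding its threshold with
  probability at most 4 * 2^(-2r) / \<rho>^(4r). The condition \<open>2 ^ N \<le> n\<close> keeps
  these lengths at least 1/n, as the increment bound demands.\<close>

lemma prob_oscillation_event:
  assumes "0 < \<rho>" "2 ^ N \<le> n"
  shows "prob (oscillation_event n m N \<rho>) \<le> 4 * (\<Sum>r\<in>{m<..N}. (1 / (2 * \<rho> ^ 4)) ^ r)"
proof -
  let ?E = "\<lambda>r j. {\<omega> \<in> space M.
     \<rho> ^ r < \<bar>emp_process n (real (Suc j) / 2 ^ r) \<omega> - emp_process n (real j / 2 ^ r) \<omega>\<bar>}"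
  have E: "prob (?E r j) \<le> 4 * (1 / 2 ^ r)\<^sup>2 / (\<rho> ^ r) ^ 4" if r: "r \<le> N" and j: "j < 2 ^ r" for r j
  proof -
    have gap: "real (Suc j) / 2 ^ r - real j / 2 ^ r = 1 / 2 ^ r" by (simp add: add_divide_distrib)
    have "real (Suc j) \<le> real (2 ^ r)" using j by (simp only: of_nat_le_iff Suc_le_eq)
    then have le1: "real (Suc j) / 2 ^ r \<le> 1" by simp
    have "(2::nat) ^ r \<le> n" using order.trans[OF power_increasing[OF r] assms(2)] by simp
    then have "real (2 ^ r) \<le> real n" by (simp only: of_nat_le_iff)
    then have "1 \<le> real n * (1 / 2 ^ r)" by simp
    with emp_process_increment_prob[of "real j / 2 ^ r" "real (Suc j) / 2 ^ r" n "\<rho> ^ r"] le1 assms(1)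
    show ?thesis unfolding gap by (simp add: divide_right_mono)
  qed
  have "prob (oscillation_event n m N \<rho>) \<le> (\<Sum>r\<in>{m<..N}. prob (\<Union>j\<in>{..<2 ^ r}. ?E r j))"
    unfolding oscillation_event_def by (intro finite_measure_subadditive_finite) auto
  also have "\<dots> \<le> (\<Sum>r\<in>{m<..N}. \<Sum>j\<in>{..<2 ^ r}. prob (?E r j))"
    by (intro sum_mono finite_measure_subadditive_finite) auto
  also have "\<dots> \<le> (\<Sum>r\<in>{m<..N}. \<Sum>j\<in>{..<(2::nat) ^ r}. 4 * (1 / 2 ^ r)\<^sup>2 / (\<rho> ^ r) ^ 4)"
    by (intro sum_mono E) auto
  also have "\<dots> = (\<Sum>r\<in>{m<..N}. 4 * (1 / (2 * \<rho> ^ 4)) ^ r)"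
  proof (intro sum.cong refl)
    fix r
    have "(\<rho> ^ r) ^ 4 = (\<rho> ^ 4) ^ r" by (simp flip: power_mult add: mult.commute)
    then show "(\<Sum>j\<in>{..<(2::nat) ^ r}. 4 * (1 / 2 ^ r)\<^sup>2 / (\<rho> ^ r) ^ 4) = 4 * (1 / (2 * \<rho> ^ 4)) ^ r"
      by (simp add: power2_eq_square power_divide power_mult_distrib field_simps)
  qed
  finally show ?thesis by (simp add: sum_distrib_left)
qed

text \<open>The conclusion exhibits an event on which the band holds at all times: the paths jump,
  and such an event is exactly what bounds an inner probability from below. The limit
  \<open>Z\<close> is left general so that the resampled bridge can be inserted.\<close>

lemma emp_process_sup_event:
  fixes Z :: "real \<Rightarrow> 'b \<Rightarrow> real"
  assumes N: "prob_space N"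
    and Z: "\<And>t. t \<in> {0..1} \<Longrightarrow> Z t \<in> borel_measurable N"
    and cf: "\<And>S c. finite S \<Longrightarrow> S \<subseteq> {0..1} \<Longrightarrow>
      (\<integral>\<omega>. iexp (\<Sum>t\<in>S. c t * Z t \<omega>) \<partial>N) = of_real (exp (- bridge_form S c / 2))"
    and c: "0 \<le> c" "c < q"
    and cover: "\<And>J. finite J \<Longrightarrow> J \<subseteq> {0..1} \<Longrightarrow>
      p \<le> measure N {x \<in> space N. \<forall>t\<in>J. \<bar>Z t x\<bar> \<le> c}"
    and "0 < \<delta>"
  shows "\<forall>\<^sub>F n in sequentially. \<exists>B\<in>events. p - \<delta> \<le> prob B \<and>
    (\<forall>\<omega>\<in>B. \<forall>u\<in>{0..1}. \<bar>emp_process n u \<omega>\<bar> \<le> q)"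
proof -
  \<comment> \<open>Half of the gap between \<open>c\<close> and \<open>q\<close> goes to the
    comparison on the grid, a quarter to the chained increments and a quarter to the error at the
    finest scale.\<close>
  define A where "A = (c + q) / 2"
  define \<epsilon> where "\<epsilon> = (q - c) / 4"
  have A: "c < A" "A + 2 * \<epsilon> = q" "0 < \<epsilon>" using c by (auto simp: A_def \<epsilon>_def field_simps)
  \<comment> \<open>Below 1, so that the thresholds are summable, and with
    \<open>2 * \<rho> ^ 4\<close> above 1, so that the failure probabilities are.\<close>
  define \<rho> :: real where "\<rho> = 9 / 10"
  have "\<forall>\<^sub>F m in sequentially. \<forall>N. (\<Sum>r\<in>{m<..N}. \<rho> ^ r) \<le> \<epsilon>"
    using A by (intro geometric_tail_le) (auto simp: \<rho>_def)
  moreover have "\<forall>\<^sub>F m in sequentially. \<forall>N. (\<Sum>r\<in>{m<..N}. (1 / (2 * \<rho> ^ 4)) ^ r) \<le> \<delta> / 8"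
    using \<open>0 < \<delta>\<close> by (intro geometric_tail_le) (auto simp: \<rho>_def power_divide)
  ultimately have "\<forall>\<^sub>F m in sequentially. (\<forall>N. (\<Sum>r\<in>{m<..N}. \<rho> ^ r) \<le> \<epsilon>) \<and>
      (\<forall>N. (\<Sum>r\<in>{m<..N}. (1 / (2 * \<rho> ^ 4)) ^ r) \<le> \<delta> / 8)"
    by eventually_elim simp
  then obtain m where m: "\<And>N. (\<Sum>r\<in>{m<..N}. \<rho> ^ r) \<le> \<epsilon>"
     "\<And>N. (\<Sum>r\<in>{m<..N}. (1 / (2 * \<rho> ^ 4)) ^ r) \<le> \<delta> / 8"
    using eventually_happens'[OF sequentially_bot] by blast
  let ?J = "dyadic_grid m"
  have J: "finite ?J" "?J \<subseteq> {0..1}" by (auto simp: dyadic_grid_subset)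
  have "\<forall>\<^sub>F n in sequentially. measure N {x \<in> space N. \<forall>t\<in>?J. \<bar>Z t x\<bar> \<le> c} - \<delta> / 2
      \<le> prob {\<omega> \<in> space M. \<forall>t\<in>?J. \<bar>emp_process n t \<omega>\<bar> < A}"
  proof (rule eventually_prob_all_abs_less[OF prob_space_axioms N J(1)])
    show "Z t \<in> borel_measurable N" if "t \<in> ?J" for t using Z J that by blast
    show "(\<lambda>n. expectation (\<lambda>\<omega>. iexp (\<Sum>t\<in>?J. d t * emp_process n t \<omega>)))
        \<longlonglongrightarrow> (\<integral>\<omega>. iexp (\<Sum>t\<in>?J. d t * Z t \<omega>) \<partial>N)" for d
      unfolding cf[OF J] by (rule emp_process_cf_tendsto[OF J])
    show "\<exists>L. \<forall>n. \<forall>t\<in>?J. prob {\<omega> \<in> space M. L < \<bar>emp_process n t \<omega>\<bar>} \<le> e" if "0 < e" for e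
      using emp_process_tight[OF that] J by blast
  qed (use A c \<open>0 < \<delta>\<close> in auto)
  moreover have "\<forall>\<^sub>F n in sequentially. max (2 ^ m) (nat \<lceil>(2 / \<epsilon>)\<^sup>2\<rceil>) \<le> n"
    by (rule eventually_ge_at_top)
  ultimately show ?thesis
  proof eventually_elim
    case (elim n)
    have n: "2 ^ m \<le> n" "1 \<le> n"
      using elim(2) one_le_power[of "2::nat" m] by linarith+
    have "(2 / \<epsilon>)\<^sup>2 \<le> real n" using elim(2) by (simp add: nat_le_iff ceiling_le_iff)
    then have sqrt_n: "2 / \<epsilon> \<le> sqrt (real n)" by (rule real_le_rsqrt)
    \<comment> \<open>The finest level to which the increment bound applies. As
      \<open>n < 2 ^ (k + 1)\<close>, the remaining error sqrt n / 2^k is below 2 / sqrt n, hence at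
      most \<epsilon> for the \<open>n\<close> under consideration.\<close>
    obtain k where k: "2 ^ k \<le> n" "n < 2 ^ (k + 1)"
      using ex_power_ivl1[of 2 n] n by auto
    have "(2::nat) ^ m < 2 ^ (k + 1)" using n k by linarith
    then have "m < k + 1" by (rule power_less_imp_less_exp[rotated]) simp
    then have "m \<le> k" by simp
    let ?G = "{\<omega> \<in> space M. \<forall>t\<in>?J. \<bar>emp_process n t \<omega>\<bar> < A}"
    have G: "?G \<in> events" by measurable
    let ?O = "oscillation_event n m k \<rho>"
    have "prob ?O \<le> \<delta> / 2"
      using prob_oscillation_event[of \<rho> k n m] k m(2)[of k] by (simp add: \<rho>_def)
    moreover have "p \<le> measure N {x \<in> space N. \<forall>t\<in>?J. \<bar>Z t x\<bar> \<le> c}"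
      by (rule cover[OF J])
    moreover have "prob ?G \<le> prob ((?G - ?O) \<union> ?O)"
      using G by (intro finite_measure_mono) auto
    moreover have "prob ((?G - ?O) \<union> ?O) \<le> prob (?G - ?O) + prob ?O"
      using G by (intro measure_Un_le) auto
    ultimately have pB: "p - \<delta> \<le> prob (?G - ?O)"
      using elim(1) by linarith
    have "\<bar>emp_process n u \<omega>\<bar> \<le> q" if \<omega>: "\<omega> \<in> ?G - ?O" and u: "u \<in> {0..1}" for \<omega> u
    proof -
      have "\<bar>emp_process n u \<omega>\<bar> \<le> A + (\<Sum>r\<in>{m<..k}. \<rho> ^ r) + sqrt (real n) / 2 ^ k"
      proof (rule dyadic_chaining[where a = "\<lambda>u. emp_process n u \<omega>" and m = m])
        show "\<bar>emp_process n (real (Suc j) / 2 ^ r) \<omega> - emp_process n (real j / 2 ^ r) \<omega>\<bar> \<le> \<rho> ^ r"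
          if "m < r" "r \<le> k" "j < 2 ^ r" for r j
          using \<omega> that unfolding oscillation_event_def by (auto simp: not_less)
      qed (use \<omega> u \<open>m \<le> k\<close> emp_process_lower in \<open>auto intro: less_imp_le\<close>)
      moreover have "sqrt (real n) / 2 ^ k \<le> \<epsilon>"
      proof -
        have "real n \<le> real (2 ^ (k + 1))" using k by (simp only: of_nat_le_iff)
        then have h1: "sqrt (real n) * sqrt (real n) \<le> 2 * 2 ^ k" by simp
        have h2: "2 \<le> \<epsilon> * sqrt (real n)" using sqrt_n A by (simp add: field_simps)
        have "2 * (sqrt (real n) * sqrt (real n)) \<le> (\<epsilon> * sqrt (real n)) * (2 * 2 ^ k)"
          by (rule mult_mono[OF h2 h1]) (use A in auto)
        then have "sqrt (real n) * sqrt (real n) \<le> sqrt (real n) * (\<epsilon> * 2 ^ k)"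
          by (simp add: algebra_simps)
        then have "sqrt (real n) \<le> \<epsilon> * 2 ^ k"
          using n by (subst (asm) mult_le_cancel_left_pos) auto
        then show ?thesis by (simp add: field_simps)
      qed
      ultimately show ?thesis using m(1)[of k] A by linarith
    qed
    then show ?case using pB G by (intro bexI[of _ "?G - ?O"]) auto
  qed
qed

end

section \<open>Distribution functions and the feasible sets\<close>

text \<open>Observations are numbered from 1, the sums of the empirical process from 0;
  \<open>Suc\<close> is the reindexing map in the application.\<close>

lemma (in prob_space) indep_sets_reindex:
  assumes inj: "inj_on f I" and indep: "indep_sets F (f ` I)"
  shows "indep_sets (\<lambda>i. F (f i)) I"
  unfolding indep_sets_def
proof (intro conjI ballI allI impI)
  show "F (f i) \<subseteq> events" if "i \<in> I" for i
    using indep that unfolding indep_sets_def by auto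
  fix J A assume J: "J \<subseteq> I" "J \<noteq> {}" "finite J" and A: "A \<in> (\<Pi> i\<in>J. F (f i))"
  define B where "B = A \<circ> inv_into I f"
  have B: "B (f j) = A j" if "j \<in> J" for j
    using that J inj by (auto simp: B_def)
  have injJ: "inj_on f J" by (rule inj_on_subset[OF inj J(1)])
  have "prob (\<Inter>k\<in>f ` J. B k) = (\<Prod>k\<in>f ` J. prob (B k))"
  proof (rule indep_setsD[OF indep])
    show "\<forall>k\<in>f ` J. B k \<in> F k" using A B by auto
  qed (use J in auto)
  moreover have "(\<Inter>k\<in>f ` J. B k) = (\<Inter>j\<in>J. A j)" using B by auto
  moreover have "(\<Prod>k\<in>f ` J. prob (B k)) = (\<Prod>j\<in>J. prob (A j))"
    using B by (simp add: prod.reindex[OF injJ])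
  ultimately show "prob (\<Inter>j\<in>J. A j) = (\<Prod>j\<in>J. prob (A j))" by simp
qed

lemma (in prob_space) indep_vars_reindex:
  assumes "inj_on f I" "indep_vars M' X (f ` I)"
  shows "indep_vars (\<lambda>i. M' (f i)) (\<lambda>i. X (f i)) I"
  using assms indep_sets_reindex[OF assms(1), of "\<lambda>i. {X i -` A \<inter> space M |A. A \<in> sets (M' i)}"]
  unfolding indep_vars_def2 by auto

text \<open>The probability integral transform. At a level strictly between 0 and 1 the set is a
  half-line, closed by continuity, so the distribution function is at most \<open>u\<close> at its
  end; right continuity gives the reverse inequality.\<close>

lemma (in real_distribution) measure_cdf_le:
  assumes cont: "continuous_on UNIV (cdf M)" and u: "u \<in> {0..1}"
  shows "measure M {t. cdf M t \<le> u} = u"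
proof -
  have closed: "closed {t. cdf M t \<le> u}" for u
    using cont by (intro closed_Collect_le continuous_on_const) auto
  then have meas: "{t. cdf M t \<le> u} \<in> sets M" for u
    by (simp add: borel_closed)
  have inner: "measure M {t. cdf M t \<le> u} = u" if u: "0 < u" "u < 1" for u
  proof -
    let ?A = "{t. cdf M t \<le> u}"
    have "\<forall>\<^sub>F t in at_bot. cdf M t < u"
      by (rule order_tendstoD(2)[OF cdf_lim_at_bot u(1)])
    then have ne: "?A \<noteq> {}"
      using eventually_happens'[of at_bot "\<lambda>t. cdf M t < u"] by (auto intro: less_imp_le)
    have "\<forall>\<^sub>F t in at_top. u < cdf M t"
      by (rule order_tendstoD(1)[OF cdf_lim_at_top_prob u(2)])
    then obtain b where b: "u < cdf M b"
      using eventually_happens'[of at_top "\<lambda>t. u < cdf M t"] by auto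
    have bdd: "bdd_above ?A"
    proof (rule bdd_aboveI[of _ b])
      fix t assume "t \<in> ?A"
      with b show "t \<le> b" using cdf_nondecreasing[of b t] by force
    qed
    have "Sup ?A \<in> ?A" using ne bdd closed by (rule closed_contains_Sup)
    then have le: "cdf M (Sup ?A) \<le> u" by simp
    have "?A = {..Sup ?A}"
    proof (intro set_eqI iffI)
      fix t assume "t \<in> {..Sup ?A}"
      with le cdf_nondecreasing[of t "Sup ?A"] show "t \<in> ?A" by simp
    qed (use bdd in \<open>auto intro: cSup_upper\<close>)
    moreover have "u \<le> cdf M (Sup ?A)"
    proof (rule tendsto_lowerbound)
      show "(cdf M \<longlongrightarrow> cdf M (Sup ?A)) (at_right (Sup ?A))"
        using cdf_is_right_cont[of "Sup ?A"] by (simp add: continuous_within)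
      have "u \<le> cdf M t" if "Sup ?A < t" for t
        using that bdd cSup_upper[of t ?A] by (cases "cdf M t \<le> u") auto
      then show "\<forall>\<^sub>F t in at_right (Sup ?A). u \<le> cdf M t"
        by (auto simp: eventually_at_filter)
    qed simp
    ultimately show ?thesis using le unfolding cdf_def by simp
  qed
  consider "u = 0" | "u = 1" | "0 < u \<and> u < 1" using u by force
  then show ?thesis
  proof cases
    case 1
    \<comment> \<open>At level 0 the set may be empty and have no supremum to work with; instead it
      is enclosed in sets of small positive level, capped at 1/2 to stay inside the range already
      treated.\<close>
    have "measure M {t. cdf M t \<le> 0} \<le> 0"
    proof (rule field_le_epsilon)
      fix e :: real assume "0 < e"
      have "measure M {t. cdf M t \<le> 0} \<le> measure M {t. cdf M t \<le> min e (1/2)}"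
        using \<open>0 < e\<close> by (intro finite_measure_mono meas) auto
      also have "\<dots> = min e (1/2)" using \<open>0 < e\<close> by (intro inner) auto
      finally show "measure M {t. cdf M t \<le> 0} \<le> 0 + e" by simp
    qed
    with 1 show ?thesis by (simp add: measure_le_0_iff)
  next
    case 2
    have "{t. cdf M t \<le> 1} = UNIV" using cdf_bounded_prob by auto
    with 2 prob_space show ?thesis by simp
  next
    case 3
    then show ?thesis by (simp add: inner)
  qed
qed

section \<open>Output distribution functions and one-sided limits of the empirical one\<close>

lemma output_cdf_eq_cdf:
  assumes "P \<in> space (prob_algebra \<X>)" and h: "h \<in> borel_measurable (Pi\<^sub>M {1..T} (\<lambda>_. \<X>))"
  shows "real_distribution (distr (input_seq T P) borel h)"
    and "output_cdf T h P = cdf (distr (input_seq T P) borel h)"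
proof -
  have P: "sets P = sets \<X>" "prob_space P" using assms by (auto simp: space_prob_algebra)
  have "sets (input_seq T P) = sets (Pi\<^sub>M {1..T} (\<lambda>_. \<X>))"
    unfolding input_seq_def by (intro sets_PiM_cong P) auto
  with h have [measurable]: "h \<in> borel_measurable (input_seq T P)"
    by (simp cong: measurable_cong_sets)
  interpret prob_space "input_seq T P"
    unfolding input_seq_def by (intro prob_space_PiM P)
  show "real_distribution (distr (input_seq T P) borel h)"
    by (rule real_distribution_distr) simp
  show "output_cdf T h P = cdf (distr (input_seq T P) borel h)"
  proof
    fix t
    have "output_cdf T h P t = measure (input_seq T P) ({x. h x \<le> t} \<inter> space (input_seq T P))"
      unfolding output_cdf_def by simp
    also have "{x. h x \<le> t} \<inter> space (input_seq T P) = h -` {..t} \<inter> space (input_seq T P)" by auto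
    also have "measure (input_seq T P) \<dots> = cdf (distr (input_seq T P) borel h) t"
      unfolding cdf_def by (subst measure_distr) auto
    finally show "output_cdf T h P t = cdf (distr (input_seq T P) borel h) t" .
  qed
qed

definition empirical_left :: "nat \<Rightarrow> (nat \<Rightarrow> real) \<Rightarrow> real \<Rightarrow> real" where
  "empirical_left n y t = (\<Sum>j=1..n. indicator {..<t} (y j)) / real n"

lemma empirical_cdf_tendsto_left: "(empirical_cdf n y \<longlongrightarrow> empirical_left n y t) (at_left t)"
proof -
  have "\<forall>\<^sub>F s in at_left t. \<forall>j\<in>{1..n}. y j \<le> s \<longleftrightarrow> y j < t"
  proof (intro eventually_ball_finite ballI)
    fix j
    show "\<forall>\<^sub>F s in at_left t. y j \<le> s \<longleftrightarrow> y j < t"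
    proof (cases "y j < t")
      case True
      then have "\<forall>\<^sub>F s in at_left t. s \<in> {y j<..<t}" by (rule eventually_at_left_real)
      then show ?thesis by eventually_elim (use True in auto)
    next
      case False
      have "\<forall>\<^sub>F s in at_left t. s \<in> {t - 1<..<t}" by (rule eventually_at_left_real) simp
      then show ?thesis by eventually_elim (use False in auto)
    qed
  qed simp
  then have "\<forall>\<^sub>F s in at_left t. empirical_cdf n y s = empirical_left n y t"
    unfolding empirical_cdf_def empirical_left_def
    by eventually_elim (auto simp: indicator_def intro!: sum.cong arg_cong2[of _ _ _ _ "(/)"])
  then show ?thesis by (rule tendsto_eventually)
qed

lemma empirical_cdf_tendsto_right: "(empirical_cdf n y \<longlongrightarrow> empirical_cdf n y t) (at_right t)"
proof -
  have "\<forall>\<^sub>F s in at_right t. \<forall>j\<in>{1..n}. y j \<le> s \<longleftrightarrow> y j \<le> t"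
  proof (intro eventually_ball_finite ballI)
    fix j
    show "\<forall>\<^sub>F s in at_right t. y j \<le> s \<longleftrightarrow> y j \<le> t"
    proof (cases "t < y j")
      case True
      then have "\<forall>\<^sub>F s in at_right t. s \<in> {t<..<y j}" by (rule eventually_at_right_real)
      then show ?thesis by eventually_elim (use True in auto)
    next
      case False
      have "\<forall>\<^sub>F s in at_right t. s \<in> {t<..<t + 1}" by (rule eventually_at_right_real) simp
      then show ?thesis by eventually_elim (use False in auto)
    qed
  qed simp
  then have "\<forall>\<^sub>F s in at_right t. empirical_cdf n y s = empirical_cdf n y t"
    unfolding empirical_cdf_def
    by eventually_elim (auto simp: indicator_def intro!: sum.cong arg_cong2[of _ _ _ _ "(/)"])
  then show ?thesis by (rule tendsto_eventually)
qed

lemma left_lim_empirical_cdf: "left_lim (empirical_cdf n y) t = empirical_left n y t"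
  unfolding left_lim_def by (intro tendsto_Lim empirical_cdf_tendsto_left) simp

lemma right_lim_empirical_cdf: "right_lim (empirical_cdf n y) t = empirical_cdf n y t"
  unfolding right_lim_def by (intro tendsto_Lim empirical_cdf_tendsto_right) simp

lemma empirical_cdf_bounds: "0 \<le> empirical_cdf n y t" "empirical_cdf n y t \<le> 1"
proof -
  show "0 \<le> empirical_cdf n y t" unfolding empirical_cdf_def by (intro divide_nonneg_nonneg sum_nonneg) auto
  have "(\<Sum>j=1..n. indicator {..t} (y j)) \<le> (\<Sum>j=1..n. 1::real)" by (intro sum_mono) auto
  then show "empirical_cdf n y t \<le> 1"
    unfolding empirical_cdf_def by (cases "n = 0") (auto simp: divide_le_eq)
qed

text \<open>Boundedness of both functions is what gives the real supremum in \<open>sup_norm\<close>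
  its intended meaning.\<close>

lemma sup_norm_diff_empirical_le_iff:
  assumes F: "\<And>t. 0 \<le> F t \<and> F t \<le> 1"
  shows "sup_norm (\<lambda>t. F t - empirical_cdf n y t) \<le> c \<longleftrightarrow> (\<forall>t. \<bar>F t - empirical_cdf n y t\<bar> \<le> c)"
proof -
  have "\<bar>F t - empirical_cdf n y t\<bar> \<le> 1" for t
    using F[of t] empirical_cdf_bounds[of n y t] by linarith
  then have "bdd_above (range (\<lambda>t. \<bar>F t - empirical_cdf n y t\<bar>))"
    by (auto intro!: bdd_aboveI[of _ 1])
  then show ?thesis unfolding sup_norm_def by (subst cSUP_le_iff) auto
qed

text \<open>The empirical function is constant between neighbouring data points and \<open>F\<close>
  is monotone, so the lower bound at \<open>t\<close> is inherited from the last data point not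
  beyond \<open>t\<close>, and the upper one from the first data point after \<open>t\<close>, whose
  left limit counts the same observations. Where there is no such point, the range [0,1] of
  \<open>F\<close> suffices.\<close>

lemma empirical_band_of_data_points:
  assumes mono: "mono F" and F: "\<And>t. 0 \<le> F t \<and> F t \<le> 1" and n: "1 \<le> n"
    and lower: "\<And>j. j \<in> {1..n} \<Longrightarrow> empirical_cdf n y (y j) - c \<le> F (y j)"
    and upper: "\<And>j. j \<in> {1..n} \<Longrightarrow> F (y j) \<le> empirical_left n y (y j) + c"
  shows "\<bar>F t - empirical_cdf n y t\<bar> \<le> c"
proof -
  \<comment> \<open>The two constraints at a single data point already force \<open>c\<close> to be
    nonnegative, on which the ranges left and right of all data rely.\<close>
  have "empirical_left n y (y 1) \<le> empirical_cdf n y (y 1)"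
    unfolding empirical_left_def empirical_cdf_def
    by (intro divide_right_mono sum_mono) (auto simp: indicator_def)
  with lower[of 1] upper[of 1] n have c: "0 \<le> c" by simp
  have "empirical_cdf n y t - c \<le> F t"
  proof (cases "\<exists>j\<in>{1..n}. y j \<le> t")
    case True
    let ?J = "{j \<in> {1..n}. y j \<le> t}"
    have "Max (y ` ?J) \<in> y ` ?J" using True by (intro Max_in) auto
    then obtain j where j: "j \<in> ?J" "y j = Max (y ` ?J)" by auto
    have le: "y i \<le> y j" if "i \<in> ?J" for i using that unfolding j(2) by (intro Max_ge) auto
    have "y i \<le> t \<longleftrightarrow> y i \<le> y j" if "i \<in> {1..n}" for i
      using that le[of i] j(1) by (cases "y i \<le> t") auto
    then have "empirical_cdf n y t = empirical_cdf n y (y j)"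
      unfolding empirical_cdf_def
      by (auto simp: indicator_def intro!: sum.cong arg_cong2[of _ _ _ _ "(/)"])
    with lower[of j] j(1) monoD[OF mono, of "y j" t] show ?thesis by simp
  next
    case False
    then have "empirical_cdf n y t = 0" by (auto simp: empirical_cdf_def indicator_def)
    with F[of t] c show ?thesis by linarith
  qed
  moreover have "F t \<le> empirical_cdf n y t + c"
  proof (cases "\<exists>j\<in>{1..n}. t < y j")
    case True
    let ?J = "{j \<in> {1..n}. t < y j}"
    have "Min (y ` ?J) \<in> y ` ?J" using True by (intro Min_in) auto
    then obtain j where j: "j \<in> ?J" "y j = Min (y ` ?J)" by auto
    have le: "y j \<le> y i" if "i \<in> ?J" for i using that unfolding j(2) by (intro Min_le) auto
    have "y i \<le> t \<longleftrightarrow> y i < y j" if "i \<in> {1..n}" for i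
      using that le[of i] j(1) by (cases "y i \<le> t") auto
    then have "empirical_cdf n y t = empirical_left n y (y j)"
      unfolding empirical_cdf_def empirical_left_def
      by (auto simp: indicator_def intro!: sum.cong arg_cong2[of _ _ _ _ "(/)"])
    with upper[of j] j(1) monoD[OF mono, of t "y j"] show ?thesis by simp
  next
    case False
    then have "(\<Sum>j=1..n. indicator {..t} (y j)) = (\<Sum>j=1..n. 1::real)"
      by (intro sum.cong) (auto simp: indicator_def not_less)
    then have "empirical_cdf n y t = 1" using n by (simp add: empirical_cdf_def)
    with F[of t] c show ?thesis by linarith
  qed
  ultimately show ?thesis by linarith
qed

text \<open>The band survives the passage to the left limit and so bounds the left limit of
  \<open>F\<close> at \<open>t\<close>. Continuity identifies that limit with \<open>F t\<close>; an
  atom at \<open>t\<close> would separate the two and could violate the bound.\<close>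

lemma data_point_upper_of_empirical_band:
  assumes "\<And>t. \<bar>F t - empirical_cdf n y t\<bar> \<le> c" and "isCont F t"
  shows "F t \<le> empirical_left n y t + c"
proof (rule tendsto_le)
  show "((\<lambda>s. empirical_cdf n y s + c) \<longlongrightarrow> empirical_left n y t + c) (at_left t)"
    by (intro tendsto_add empirical_cdf_tendsto_left tendsto_const)
  show "(F \<longlongrightarrow> F t) (at_left t)"
    using assms(2) by (auto simp: isCont_def intro: tendsto_within_subset)
  have "F s \<le> empirical_cdf n y s + c" for s using assms(1)[of s] by linarith
  then show "\<forall>\<^sub>F s in at_left t. F s \<le> empirical_cdf n y s + c" by simp
qed simp

lemma pointwise_feasible_ks_feasible:
  assumes PX: "PX \<subseteq> space (prob_algebra \<X>)"
    and h: "h \<in> borel_measurable (Pi\<^sub>M {1..T} (\<lambda>_. \<X>))" and n: "1 \<le> n"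
  shows "pointwise_feasible T h PX q n y \<subseteq> ks_feasible T h PX q n y"
    and "P \<in> ks_feasible T h PX q n y \<Longrightarrow> \<forall>j\<in>{1..n}. isCont (output_cdf T h P) (y j) \<Longrightarrow>
           P \<in> pointwise_feasible T h PX q n y"
proof -
  let ?c = "q / sqrt (real n)"
  have cdf: "mono (output_cdf T h P)" "0 \<le> output_cdf T h P t \<and> output_cdf T h P t \<le> 1"
    if P: "P \<in> PX" for P t
  proof -
    from P PX have P': "P \<in> space (prob_algebra \<X>)" by blast
    interpret real_distribution "distr (input_seq T P) borel h"
      by (rule output_cdf_eq_cdf(1)[OF P' h])
    show "mono (output_cdf T h P)" "0 \<le> output_cdf T h P t \<and> output_cdf T h P t \<le> 1"
      unfolding output_cdf_eq_cdf(2)[OF P' h]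
      by (auto intro!: monoI cdf_nondecreasing cdf_nonneg cdf_bounded_prob)
  qed
  show "pointwise_feasible T h PX q n y \<subseteq> ks_feasible T h PX q n y"
  proof
    fix P assume P: "P \<in> pointwise_feasible T h PX q n y"
    then have "P \<in> PX" by (simp add: pointwise_feasible_def)
    have "\<bar>output_cdf T h P t - empirical_cdf n y t\<bar> \<le> ?c" for t
    proof (rule empirical_band_of_data_points[OF cdf[OF \<open>P \<in> PX\<close>] n])
      fix j assume "j \<in> {1..n}"
      with P show "empirical_cdf n y (y j) - ?c \<le> output_cdf T h P (y j)"
        "output_cdf T h P (y j) \<le> empirical_left n y (y j) + ?c"
        unfolding pointwise_feasible_def left_lim_empirical_cdf right_lim_empirical_cdf
          output_cdf_def by auto
    qed
    then show "P \<in> ks_feasible T h PX q n y"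
      using \<open>P \<in> PX\<close> sup_norm_diff_empirical_le_iff[OF cdf(2)[OF \<open>P \<in> PX\<close>]]
      by (simp add: ks_feasible_def)
  qed
  assume P: "P \<in> ks_feasible T h PX q n y" and cont: "\<forall>j\<in>{1..n}. isCont (output_cdf T h P) (y j)"
  then have "P \<in> PX" by (simp add: ks_feasible_def)
  have band: "\<bar>output_cdf T h P t - empirical_cdf n y t\<bar> \<le> ?c" for t
    using P sup_norm_diff_empirical_le_iff[OF cdf(2)[OF \<open>P \<in> PX\<close>]] by (simp add: ks_feasible_def)
  have "empirical_cdf n y (y j) - ?c \<le> output_cdf T h P (y j)" for j
    using band[of "y j"] by linarith
  moreover have "output_cdf T h P (y j) \<le> empirical_left n y (y j) + ?c" if "j \<in> {1..n}" for j
    using cont that by (intro data_point_upper_of_empirical_band band) auto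
  ultimately show "P \<in> pointwise_feasible T h PX q n y"
    using \<open>P \<in> PX\<close>
    unfolding pointwise_feasible_def left_lim_empirical_cdf right_lim_empirical_cdf
      output_cdf_def by auto
qed

lemma (in prob_space) prob_le_inner_prob:
  assumes "B \<in> events" "B \<subseteq> A"
  shows "prob B \<le> inner_prob M A"
  unfolding inner_prob_def
  using assms by (intro cSUP_upper) (auto intro!: bdd_aboveI[of _ 1])

text \<open>On flat pieces of \<open>F\<close> the transformed sample loses information, but monotonicity alone gives
  the two comparisons needed here, so no null set has to be removed.\<close>

lemma empirical_band_of_transformed:
  fixes F :: "real \<Rightarrow> real" and y :: "nat \<Rightarrow> real"
  assumes mono: "mono F" and F: "\<And>t. 0 \<le> F t \<and> F t \<le> 1"
    and G: "\<And>u. u \<in> {0..1} \<Longrightarrow> \<bar>empirical_cdf n (F \<circ> y) u - u\<bar> \<le> c"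
  shows "\<bar>F t - empirical_cdf n y t\<bar> \<le> c"
proof -
  have "empirical_cdf n y t \<le> empirical_cdf n (F \<circ> y) (F t)"
    unfolding empirical_cdf_def
    by (intro divide_right_mono sum_mono) (auto simp: indicator_def monoD[OF mono])
  with G[of "F t"] F[of t] have "empirical_cdf n y t - F t \<le> c" by auto
  moreover have "F t - c \<le> empirical_cdf n y t"
  proof (cases "F t = 0")
    case True
    have "0 \<le> c" using G[of 0] by (meson abs_ge_zero atLeastAtMost_iff order.trans order_refl zero_le_one)
    with True show ?thesis using empirical_cdf_bounds(1)[of n y t] by simp
  next
    case False
    \<comment> \<open>Approached through levels \<open>s\<close> strictly below \<open>F t\<close>:
      then \<open>F (y j) \<le> s\<close> forces \<open>y j \<le> t\<close>, whereas
      \<open>F (y j) \<le> F t\<close> also holds for data to the right of \<open>t\<close> on the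
      same flat piece.\<close>
    have "F t \<le> empirical_cdf n y t + c"
    proof (rule dense_le_bounded[of 0])
      show "0 < F t" using False F[of t] by simp
      fix s assume s: "0 < s" "s < F t"
      have "empirical_cdf n (F \<circ> y) s \<le> empirical_cdf n y t"
        unfolding empirical_cdf_def
      proof (intro divide_right_mono sum_mono)
        fix j
        have "y j \<le> t" if "F (y j) \<le> s"
          using that s monoD[OF mono, of t "y j"] by (cases "y j \<le> t") auto
        then show "(indicator {..s} ((F \<circ> y) j) :: real) \<le> indicator {..t} (y j)"
          by (auto simp: indicator_def)
      qed simp
      with G[of s] s F[of t] show "s \<le> empirical_cdf n y t + c" by auto
    qed
    then show ?thesis by simp
  qed
  ultimately show ?thesis by linarith
qed

lemma (in iid_uniform) emp_process_eq:
  assumes "1 \<le> n"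
  shows "emp_process n u \<omega> / sqrt (real n) = (\<Sum>i<n. indicator {..u} (U i \<omega>)) / real n - u"
  using assms by (simp add: emp_process_def centered_def sum_subtractf diff_divide_distrib)

theorem ks_coverage:
  fixes Y :: "nat \<Rightarrow> 'd \<Rightarrow> real"
  assumes D: "prob_space D" and indep: "prob_space.indep_vars D (\<lambda>_. borel) Y {1..}"
    and distr: "\<And>i. 1 \<le> i \<Longrightarrow> distr D borel (Y i) = \<nu>"
    and cont: "continuous_on UNIV (cdf \<nu>)"
    and BB: "brownian_bridge W BB" and p: "0 < p" "p < 1" and "0 < \<delta>"
  shows "\<forall>\<^sub>F n in sequentially. \<exists>B\<in>sets D. p - \<delta> \<le> measure D B \<and>
    (\<forall>\<omega>\<in>B. \<forall>t. \<bar>cdf \<nu> t - empirical_cdf n (\<lambda>j. Y j \<omega>) t\<bar> \<le> sup_bridge_quantile W BB p / sqrt (real n))"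
proof -
  interpret D: prob_space D by fact
  interpret bridge W BB by unfold_locales fact
  have Y [measurable]: "1 \<le> i \<Longrightarrow> Y i \<in> borel_measurable D" for i
    using indep unfolding D.indep_vars_def2 by auto
  interpret \<nu>: real_distribution \<nu>
    unfolding distr[of 1, simplified, symmetric] by (rule D.real_distribution_distr) simp
  let ?F = "cdf \<nu>"
  have [measurable]: "?F \<in> borel_measurable borel"
    using cont by (rule borel_measurable_continuous_onI)
  have F: "mono ?F" "\<And>t. 0 \<le> ?F t \<and> ?F t \<le> 1"
    by (auto intro!: monoI \<nu>.cdf_nondecreasing \<nu>.cdf_nonneg \<nu>.cdf_bounded_prob)
  let ?U = "\<lambda>i \<omega>. ?F (Y (Suc i) \<omega>)"
  interpret U: iid_uniform D ?U "distr \<nu> borel ?F"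
  proof unfold_locales
    have "D.indep_vars (\<lambda>_. borel) Y (Suc ` UNIV)"
      by (rule D.indep_vars_subset[OF indep]) auto
    then have "D.indep_vars (\<lambda>_. borel) (\<lambda>i. Y (Suc i)) UNIV"
      by (rule D.indep_vars_reindex[where f = Suc and X = Y and M' = "\<lambda>_. borel" and I = UNIV, rotated])
        simp
    then show "D.indep_vars (\<lambda>_. borel) ?U UNIV"
      by (rule D.indep_vars_compose2) simp
    show "distr D borel (?U i) = distr \<nu> borel ?F" for i
      using distr_distr[of ?F borel borel "Y (Suc i)" D] distr[of "Suc i"] by (simp add: comp_def)
    fix u :: real assume u: "u \<in> {0..1}"
    have "measure (distr \<nu> borel ?F) {..u} = measure \<nu> (?F -` {..u} \<inter> space \<nu>)"
      by (rule measure_distr) auto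
    also have "?F -` {..u} \<inter> space \<nu> = {t. ?F t \<le> u}" by auto
    finally show "measure (distr \<nu> borel ?F) {..u} = u"
      using \<nu>.measure_cdf_le[OF cont u] by simp
  qed
  let ?q = "sup_bridge_quantile W BB p"
  \<comment> \<open>One half of \<delta> pays for the step below the quantile, the other for the
    passage to the empirical process.\<close>
  obtain c where c: "0 \<le> c" "c < ?q" "\<And>J. finite J \<Longrightarrow> J \<subseteq> {0..1} \<Longrightarrow>
    p - \<delta> / 2 \<le> measure resample_space {x \<in> space resample_space. \<forall>t\<in>J. \<bar>resampled t x\<bar> \<le> c}"
    using resampled_coverage[OF p, of "\<delta> / 2"] \<open>0 < \<delta>\<close> by auto
  have "\<forall>\<^sub>F n in sequentially. \<exists>B\<in>sets D. p - \<delta> / 2 - \<delta> / 2 \<le> measure D B \<and>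
    (\<forall>\<omega>\<in>B. \<forall>u\<in>{0..1}. \<bar>U.emp_process n u \<omega>\<bar> \<le> ?q)"
  proof (rule U.emp_process_sup_event[OF prob_space_resample resampled_measurable])
    show "(\<integral>x. iexp (\<Sum>t\<in>S. d t * resampled t x) \<partial>resample_space) =
        of_real (exp (- bridge_form S d / 2))" if "finite S" "S \<subseteq> {0..1}" for S d
      unfolding resampled_cf[OF that] BB_sum(4)[OF that] BB_sum(2)[OF that] ..
  qed (use c \<open>0 < \<delta>\<close> in auto)
  with eventually_ge_at_top[of 1] show ?thesis
  proof eventually_elim
    case (elim n)
    then obtain B where B: "B \<in> sets D" "p - \<delta> \<le> measure D B"
      "\<And>\<omega> u. \<omega> \<in> B \<Longrightarrow> u \<in> {0..1} \<Longrightarrow> \<bar>U.emp_process n u \<omega>\<bar> \<le> ?q"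
      by auto
    have "\<bar>?F t - empirical_cdf n (\<lambda>j. Y j \<omega>) t\<bar> \<le> ?q / sqrt (real n)" if \<omega>: "\<omega> \<in> B" for \<omega> t
    proof (rule empirical_band_of_transformed[OF F])
      fix u :: real assume u: "u \<in> {0..1}"
      have "empirical_cdf n (?F \<circ> (\<lambda>j. Y j \<omega>)) u - u = U.emp_process n u \<omega> / sqrt (real n)"
        unfolding U.emp_process_eq[OF elim(1)] empirical_cdf_def by (simp add: sum.atLeast1_atMost_eq)
      with B(3)[OF \<omega> u] show "\<bar>empirical_cdf n (?F \<circ> (\<lambda>j. Y j \<omega>)) u - u\<bar> \<le> ?q / sqrt (real n)"
        by (simp add: abs_divide divide_right_mono)
    qed
    with B show ?case by blast
  qed
qed

text \<open>The sup-norm band controls left limits of the output distribution function at the data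
  points, whereas the upper pointwise constraint concerns its values there. Equality of the feasible
  sets is therefore tied to continuity at those points, while the inclusion of the pointwise set in
  the band holds throughout. Once the feasible sets agree, so do the optimal values for any
  target.\<close>

theorem theorem1:
  fixes \<X> :: "'x measure"
    and PX :: "'x measure set"
    and P0 :: "'x measure"
    and T :: nat
    and h :: "(nat \<Rightarrow> 'x) \<Rightarrow> real"
    and \<psi> :: "'x measure \<Rightarrow> real"
    and D :: "'d measure"
    and Y :: "nat \<Rightarrow> 'd \<Rightarrow> real"
    and W :: "'w measure"
    and BB :: "real \<Rightarrow> 'w \<Rightarrow> real"
    and \<alpha> q :: real
  assumes "PX \<subseteq> space (prob_algebra \<X>)"
    and "P0 \<in> PX"
    and "h \<in> borel_measurable (Pi\<^sub>M {1..T} (\<lambda>_. \<X>))"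
    and "prob_space D"
    and "prob_space.indep_vars D (\<lambda>_. borel) Y {1..}"
    and "\<And>i. 1 \<le> i \<Longrightarrow> distr D borel (Y i) = distr (input_seq T P0) borel h"
    and "0 < \<alpha>" and "\<alpha> < 1"
    and "brownian_bridge W BB"
    and "q = sup_bridge_quantile W BB (1 - \<alpha>)"
    and "continuous_on UNIV (output_cdf T h P0)"
  shows "ereal (1 - \<alpha>) \<le> liminf (\<lambda>n. ereal (inner_prob D
             {\<omega> \<in> space D.
                min_value \<psi> (ks_feasible T h PX q n (\<lambda>j. Y j \<omega>)) \<le> ereal (\<psi> P0) \<and>
                ereal (\<psi> P0) \<le> max_value \<psi> (ks_feasible T h PX q n (\<lambda>j. Y j \<omega>))}))
       \<and> (\<forall>n\<ge>1. \<forall>y :: nat \<Rightarrow> real.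
           pointwise_feasible T h PX q n y \<subseteq> ks_feasible T h PX q n y \<and>
           (\<forall>P \<in> PX. (\<forall>j\<in>{1..n}. isCont (output_cdf T h P) (y j)) \<longrightarrow>
              (P \<in> ks_feasible T h PX q n y \<longleftrightarrow> P \<in> pointwise_feasible T h PX q n y)) \<and>
           ((\<forall>P \<in> ks_feasible T h PX q n y. \<forall>j\<in>{1..n}. isCont (output_cdf T h P) (y j)) \<longrightarrow>
              ks_feasible T h PX q n y = pointwise_feasible T h PX q n y \<and>
              max_value \<psi> (ks_feasible T h PX q n y)
                = max_value \<psi> (pointwise_feasible T h PX q n y) \<and>
              min_value \<psi> (ks_feasible T h PX q n y)
                = min_value \<psi> (pointwise_feasible T h PX q n y)))"
proof (rule conjI)
  let ?A = "\<lambda>n. {\<omega> \<in> space D.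
      min_value \<psi> (ks_feasible T h PX q n (\<lambda>j. Y j \<omega>)) \<le> ereal (\<psi> P0) \<and>
      ereal (\<psi> P0) \<le> max_value \<psi> (ks_feasible T h PX q n (\<lambda>j. Y j \<omega>))}"
  let ?\<nu> = "distr (input_seq T P0) borel h"
  interpret D: prob_space D by fact
  have P0: "P0 \<in> space (prob_algebra \<X>)" using assms(1,2) by blast
  note F0 = output_cdf_eq_cdf[OF P0 assms(3)]
  interpret \<nu>: real_distribution ?\<nu> by (rule F0(1))
  have F: "0 \<le> output_cdf T h P0 t \<and> output_cdf T h P0 t \<le> 1" for t
    unfolding F0(2) by (auto intro: \<nu>.cdf_nonneg \<nu>.cdf_bounded_prob)
  show "ereal (1 - \<alpha>) \<le> liminf (\<lambda>n. ereal (inner_prob D (?A n)))"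
  proof (rule ereal_le_epsilon2)
    fix \<delta> :: real assume "0 < \<delta>"
    have "\<forall>\<^sub>F n in sequentially. \<exists>B\<in>sets D. 1 - \<alpha> - \<delta> \<le> measure D B \<and>
      (\<forall>\<omega>\<in>B. \<forall>t. \<bar>cdf ?\<nu> t - empirical_cdf n (\<lambda>j. Y j \<omega>) t\<bar>
        \<le> sup_bridge_quantile W BB (1 - \<alpha>) / sqrt (real n))"
      by (rule ks_coverage[OF assms(4,5,6)])
        (use assms \<open>0 < \<delta>\<close> F0(2) in auto)
    then have "\<forall>\<^sub>F n in sequentially. ereal (1 - \<alpha> - \<delta>) \<le> ereal (inner_prob D (?A n))"
    proof eventually_elim
      case (elim n)
      then obtain B where B: "B \<in> sets D" "1 - \<alpha> - \<delta> \<le> measure D B"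
        "\<And>\<omega> t. \<omega> \<in> B \<Longrightarrow> \<bar>output_cdf T h P0 t - empirical_cdf n (\<lambda>j. Y j \<omega>) t\<bar> \<le> q / sqrt (real n)"
        unfolding F0(2) assms(10) by blast
      have "P0 \<in> ks_feasible T h PX q n (\<lambda>j. Y j \<omega>)" if "\<omega> \<in> B" for \<omega>
        using B(3)[OF that] assms(2) unfolding ks_feasible_def
        by (simp add: sup_norm_diff_empirical_le_iff[OF F])
      then have sub: "B \<subseteq> ?A n"
        using sets.sets_into_space[OF B(1)]
        by (auto simp: min_value_def max_value_def intro: INF_lower SUP_upper)
      show ?case using order.trans[OF B(2) D.prob_le_inner_prob[OF B(1) sub]] by simp
    qed
    then have "ereal (1 - \<alpha> - \<delta>) \<le> liminf (\<lambda>n. ereal (inner_prob D (?A n)))"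
      by (rule Liminf_bounded)
    then have "ereal (1 - \<alpha> - \<delta>) + ereal \<delta> \<le> liminf (\<lambda>n. ereal (inner_prob D (?A n))) + ereal \<delta>"
      by (rule add_right_mono)
    then show "ereal (1 - \<alpha>) \<le> liminf (\<lambda>n. ereal (inner_prob D (?A n))) + ereal \<delta>"
      by simp
  qed
next
  show "\<forall>n\<ge>1. \<forall>y :: nat \<Rightarrow> real.
           pointwise_feasible T h PX q n y \<subseteq> ks_feasible T h PX q n y \<and>
           (\<forall>P \<in> PX. (\<forall>j\<in>{1..n}. isCont (output_cdf T h P) (y j)) \<longrightarrow>
              (P \<in> ks_feasible T h PX q n y \<longleftrightarrow> P \<in> pointwise_feasible T h PX q n y)) \<and>
           ((\<forall>P \<in> ks_feasible T h PX q n y. \<forall>j\<in>{1..n}. isCont (output_cdf T h P) (y j)) \<longrightarrow>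
              ks_feasible T h PX q n y = pointwise_feasible T h PX q n y \<and>
              max_value \<psi> (ks_feasible T h PX q n y)
                = max_value \<psi> (pointwise_feasible T h PX q n y) \<and>
              min_value \<psi> (ks_feasible T h PX q n y)
                = min_value \<psi> (pointwise_feasible T h PX q n y))"
  proof (intro allI impI)
    fix n :: nat and y :: "nat \<Rightarrow> real" assume n: "1 \<le> n"
    note sub = pointwise_feasible_ks_feasible[OF assms(1,3) n, where q = q and y = y]
    have eq: "ks_feasible T h PX q n y = pointwise_feasible T h PX q n y"
      if "\<forall>P \<in> ks_feasible T h PX q n y. \<forall>j\<in>{1..n}. isCont (output_cdf T h P) (y j)"
      using sub that by blast
    show "pointwise_feasible T h PX q n y \<subseteq> ks_feasible T h PX q n y \<and>
           (\<forall>P \<in> PX. (\<forall>j\<in>{1..n}. isCont (output_cdf T h P) (y j)) \<longrightarrow>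
              (P \<in> ks_feasible T h PX q n y \<longleftrightarrow> P \<in> pointwise_feasible T h PX q n y)) \<and>
           ((\<forall>P \<in> ks_feasible T h PX q n y. \<forall>j\<in>{1..n}. isCont (output_cdf T h P) (y j)) \<longrightarrow>
              ks_feasible T h PX q n y = pointwise_feasible T h PX q n y \<and>
              max_value \<psi> (ks_feasible T h PX q n y)
                = max_value \<psi> (pointwise_feasible T h PX q n y) \<and>
              min_value \<psi> (ks_feasible T h PX q n y)
                = min_value \<psi> (pointwise_feasible T h PX q n y))"
      using sub eq by auto
  qed
qed

end
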